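(* Let $q,r\ge 2$ be integers and let $p^{(2N)}(o,o)$ be the $2N$-step return probability of simple random walk on $\mathrm{DL}(q,r)$. Let $$\xi_1=\Bigl(\frac{2\pi^2}{\log q}\Bigr)^{1/3},\qquad B_1=3\Bigl(\frac{\pi\log q}{2}\Bigr)^{2/3},\qquad C_1=6\Bigl(\frac{(\log q)^2}{4\pi}\Bigr)^{2/3},\qquad \rho(P)=\frac{2\sqrt{qr}}{q+r}.$$ (i) If $r>q$ then, as $N\to\infty$, $$p^{(2N)}(o,o)\sim A_1\,\rho(P)^{2N}\,\exp\bigl(-B_1N^{1/3}\bigr)\,N^{-5/6},$$ where $$A_1=4\pi^2\,\xi_1^{-3}\,(2\pi/C_1)^{1/2}\,\frac{qr(q+r)(q-1)(r-1)}{(r-q)^3}.$$ (ii) If $r=q$ then, as $N\to\infty$, $$p^{(2N)}(o,o)\sim\bar A_1\,\exp\bigl(-B_1N^{1/3}\bigr)\,N^{1/6},\qquad\text{where}\quad \bar A_1=2(q-1)^2\,(2\pi/C_1)^{1/2}.$$ Here $\sim$ means that the quotient of the two sides tends to $1$.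
   Context: Trees. For an integer $p\ge2$, $\mathbb T_p$ is the homogeneous tree of degree $p+1$ with a chosen root $o$ and a chosen reference end $\omega$ (an end is an equivalence class of geodesic rays, two rays being equivalent if their supports have finite symmetric difference). For a vertex $x$, $\overline{x\,\omega}$ is the unique geodesic ray from $x$ representing $\omega$; for vertices $v,z$ the confluent $b=v\curlywedge z$ is defined by $\overline{v\,\omega}\cap\overline{z\,\omega}=\overline{b\,\omega}$. The Busemann function is $\mathfrak h(x)=d(x,x\curlywedge o)-d(o,x\curlywedge o)$. Diestel-Leader graph. Let $\mathbb T_q$, $\mathbb T_r$ have roots $o_1,o_2$ and reference ends $\omega_1,\omega_2$. $\mathrm{DL}(q,r)$ has vertex set $\{x_1x_2\in\mathbb T_q\times\mathbb T_r:\mathfrak h(x_1)+\mathfrak h(x_2)=0\}$, with $x_1x_2\sim y_1y_2$ iff $x_1\sim y_1$ and $x_2\sim y_2$. It is $(q+r)$-regular and vertex-transitive; $o=o_1o_2$. Simple random walk moves from $x$ to each neighbour with probability $1/(q+r)$; $p^{(N)}(x,y)$ is the probability to be at $y$ after $N$ steps when starting at $x$. *)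

theory Defs
  imports "HOL-Probability.Probability" "HOL-Library.Landau_Symbols"
begin

text \<open>A graph is given by its adjacency relation on a type; all elements of the type are vertices.\<close>

definition is_tree :: "('a \<Rightarrow> 'a \<Rightarrow> bool) \<Rightarrow> bool" where
  "is_tree E \<longleftrightarrow> symp E \<and> irreflp E \<and> (\<forall>x y. E\<^sup>*\<^sup>* x y) \<and>
     \<not> (\<exists>c. length c \<ge> 3 \<and> distinct c \<and> successively E c \<and> E (last c) (hd c))"

definition homogeneous_tree :: "nat \<Rightarrow> ('a \<Rightarrow> 'a \<Rightarrow> bool) \<Rightarrow> bool" where
  "homogeneous_tree p E \<longleftrightarrow> is_tree E \<and> (\<forall>x. card {y. E x y} = p + 1)"

definition graph_dist :: "('a \<Rightarrow> 'a \<Rightarrow> bool) \<Rightarrow> 'a \<Rightarrow> 'a \<Rightarrow> nat" where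
  "graph_dist E x y = (LEAST n. (E ^^ n) x y)"

definition geodesic_ray :: "('a \<Rightarrow> 'a \<Rightarrow> bool) \<Rightarrow> (nat \<Rightarrow> 'a) \<Rightarrow> bool" where
  "geodesic_ray E g \<longleftrightarrow> (\<forall>i j. i \<le> j \<longrightarrow> graph_dist E (g i) (g j) = j - i)"

definition ray_equiv :: "('a \<Rightarrow> 'a \<Rightarrow> bool) \<Rightarrow> ((nat \<Rightarrow> 'a) \<times> (nat \<Rightarrow> 'a)) set" where
  "ray_equiv E = {(g, h). geodesic_ray E g \<and> geodesic_ray E h \<and>
     finite (sym_diff (range g) (range h))}"

definition ends :: "('a \<Rightarrow> 'a \<Rightarrow> bool) \<Rightarrow> (nat \<Rightarrow> 'a) set set" where
  "ends E = {g. geodesic_ray E g} // ray_equiv E"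

definition ray_to :: "(nat \<Rightarrow> 'a) set \<Rightarrow> 'a \<Rightarrow> nat \<Rightarrow> 'a" where
  "ray_to \<omega> x = (THE g. g \<in> \<omega> \<and> g 0 = x)"

definition confluent :: "(nat \<Rightarrow> 'a) set \<Rightarrow> 'a \<Rightarrow> 'a \<Rightarrow> 'a" where
  "confluent \<omega> v z =
     (THE b. range (ray_to \<omega> v) \<inter> range (ray_to \<omega> z) = range (ray_to \<omega> b))"

definition busemann ::
  "('a \<Rightarrow> 'a \<Rightarrow> bool) \<Rightarrow> 'a \<Rightarrow> (nat \<Rightarrow> 'a) set \<Rightarrow> 'a \<Rightarrow> int" where
  "busemann E rt \<omega> x = int (graph_dist E x (confluent \<omega> x rt))
                      - int (graph_dist E rt (confluent \<omega> x rt))"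

definition DL_verts ::
  "('a \<Rightarrow> 'a \<Rightarrow> bool) \<Rightarrow> 'a \<Rightarrow> (nat \<Rightarrow> 'a) set \<Rightarrow>
   ('b \<Rightarrow> 'b \<Rightarrow> bool) \<Rightarrow> 'b \<Rightarrow> (nat \<Rightarrow> 'b) set \<Rightarrow> ('a \<times> 'b) set" where
  "DL_verts E1 o1 \<omega>1 E2 o2 \<omega>2 =
     {(x1, x2). busemann E1 o1 \<omega>1 x1 + busemann E2 o2 \<omega>2 x2 = 0}"

definition DL_nbrs ::
  "('a \<Rightarrow> 'a \<Rightarrow> bool) \<Rightarrow> 'a \<Rightarrow> (nat \<Rightarrow> 'a) set \<Rightarrow>
   ('b \<Rightarrow> 'b \<Rightarrow> bool) \<Rightarrow> 'b \<Rightarrow> (nat \<Rightarrow> 'b) set \<Rightarrow> 'a \<times> 'b \<Rightarrow> ('a \<times> 'b) set" where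
  "DL_nbrs E1 o1 \<omega>1 E2 o2 \<omega>2 x =
     {y \<in> DL_verts E1 o1 \<omega>1 E2 o2 \<omega>2. E1 (fst x) (fst y) \<and> E2 (snd x) (snd y)}"

text \<open>
  Law after N steps of the simple random walk started at x. For homogeneous trees of degrees
  q + 1 and r + 1 every vertex of the Diestel-Leader graph has exactly q + r neighbours, so the
  uniform distribution on the neighbours gives each of them probability 1 / (q + r).
\<close>

definition DL_walk ::
  "('a \<Rightarrow> 'a \<Rightarrow> bool) \<Rightarrow> 'a \<Rightarrow> (nat \<Rightarrow> 'a) set \<Rightarrow>
   ('b \<Rightarrow> 'b \<Rightarrow> bool) \<Rightarrow> 'b \<Rightarrow> (nat \<Rightarrow> 'b) set \<Rightarrow> nat \<Rightarrow> 'a \<times> 'b \<Rightarrow> ('a \<times> 'b) pmf" where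
  "DL_walk E1 o1 \<omega>1 E2 o2 \<omega>2 N x =
     ((\<lambda>M. bind_pmf M (\<lambda>y. pmf_of_set (DL_nbrs E1 o1 \<omega>1 E2 o2 \<omega>2 y))) ^^ N) (return_pmf x)"

definition DL_prob ::
  "('a \<Rightarrow> 'a \<Rightarrow> bool) \<Rightarrow> 'a \<Rightarrow> (nat \<Rightarrow> 'a) set \<Rightarrow>
   ('b \<Rightarrow> 'b \<Rightarrow> bool) \<Rightarrow> 'b \<Rightarrow> (nat \<Rightarrow> 'b) set \<Rightarrow> nat \<Rightarrow> 'a \<times> 'b \<Rightarrow> 'a \<times> 'b \<Rightarrow> real" where
  "DL_prob E1 o1 \<omega>1 E2 o2 \<omega>2 N x y = pmf (DL_walk E1 o1 \<omega>1 E2 o2 \<omega>2 N x) y"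

definition xi1 :: "nat \<Rightarrow> real" where
  "xi1 q = (2 * pi\<^sup>2 / ln (real q)) powr (1/3)"

definition B1 :: "nat \<Rightarrow> real" where
  "B1 q = 3 * (pi * ln (real q) / 2) powr (2/3)"

definition C1 :: "nat \<Rightarrow> real" where
  "C1 q = 6 * ((ln (real q))\<^sup>2 / (4 * pi)) powr (2/3)"

definition rho :: "nat \<Rightarrow> nat \<Rightarrow> real" where
  "rho q r = 2 * sqrt (real q * real r) / (real q + real r)"

definition A1 :: "nat \<Rightarrow> nat \<Rightarrow> real" where
  "A1 q r = 4 * pi\<^sup>2 * xi1 q powr (-3) * (2 * pi / C1 q) powr (1/2) *
     (real q * real r * (real q + real r) * (real q - 1) * (real r - 1) / (real r - real q) ^ 3)"

definition A1_bar :: "nat \<Rightarrow> real" where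
  "A1_bar q = 2 * (real q - 1)\<^sup>2 * (2 * pi / C1 q) powr (1/2)"

end

theory Submission
  imports Defs "HOL-Real_Asymp.Real_Asymp"
begin

text \<open>
  A reference end turns a homogeneous tree into a genealogical tree: every vertex has one
  neighbour closer to the end, its parent, and all other neighbours are its children
  (\<open>adj_iff_parent\<close>); the Busemann function drops by one at each parent
  (\<open>busemann_parent\<close>). A step in the Diestel-Leader graph moves one coordinate to its parent and
  the other to a child, so a walk is described by its height profile, a sequence of plus and
  minus ones, together with independent choices of children in the two trees. Over a closed
  profile (a bridge) of length $2N$ whose greatest height above the root is $m$ in the first tree
  and $n$ in the second one, exactly $q^{N-m} r^{N-n}$ walks return to the root:
  among the $q^m$ descendants, at the level of the root, of the highest ancestor visited, all are
  equally likely. Hence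
  \[ p^{(2N)}(o,o) = (qr)^N (q+r)^{-2N} \sum_{\mathrm{bridges}} q^{-m} r^{-n}, \]
  which is \<open>return_probability_sum\<close>.

  Writing $q^{-m} = (1-1/q) \sum_{i \ge m} q^{-i}$, and likewise for $r$, replaces exact extrema by
  bounds on them. Bridges in a strip with $k-1$ levels are counted by the eigenvectors
  $\sin(\pi j a/k)$ and eigenvalues $2\cos(\pi j/k)$ of a path with $k-1$ vertices
  (\<open>card_strip_paths\<close>). The result, \<open>return_probability_modes\<close>, is $\rho^{2N}$ times a series over
  the width $k$ of terms $q^{-k} w_{k,j} \cos^{2N}(\pi j/k)$, where $w_{k,j}$ is the
  \<open>mode_weight\<close> of $q/r$.

  In this series only $j = 1$ and $j = k-1$ matter. Their terms behave like
  $\exp(-k \log q - \pi^2 N/k^2)$, with a sharp maximum at $k \approx \xi_1 N^{1/3}$ and a width of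
  order $N^{1/6}$; Laplace's method (\<open>laplace_sum\<close>) gives the exponent $B_1 N^{1/3}$ and the
  integral of $\exp(-C_1 y^2/2)$. The power of $N$ and the constant come from the weight
  of the leading mode: $k/2$ if $q = r$ (\<open>mode_weight_one\<close>), and asymptotically a multiple of
  $k^{-2}$ if $q < r$ (\<open>mode_weight_limit\<close>), because then the weight $(q/r)^b$ keeps the root within
  bounded distance of the boundary of the strip, where the first eigenvector is small.
\<close>

section \<open>Trees with a reference end\<close>

text \<open>
  Walks are functions on the natural numbers of which only the first \<open>n + 1\<close> values matter, so
  that finite walks and rays are treated alike.
\<close>

definition reduced_walk :: "('a \<Rightarrow> 'a \<Rightarrow> bool) \<Rightarrow> nat \<Rightarrow> (nat \<Rightarrow> 'a) \<Rightarrow> bool" where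
  "reduced_walk E n w \<longleftrightarrow> (\<forall>i<n. E (w i) (w (Suc i))) \<and> (\<forall>i. Suc (Suc i) \<le> n \<longrightarrow> w i \<noteq> w (Suc (Suc i)))"

lemma reduced_walk_mono: "reduced_walk E n w \<Longrightarrow> m \<le> n \<Longrightarrow> reduced_walk E m w"
  by (auto simp: reduced_walk_def)

locale tree =
  fixes E :: "'a \<Rightarrow> 'a \<Rightarrow> bool"
  assumes tree: "is_tree E"
begin

lemma adj_sym: "E x y \<Longrightarrow> E y x"
  and adj_irrefl: "\<not> E x x"
  and connected: "E\<^sup>*\<^sup>* x y"
  and no_cycle: "\<lbrakk>length c \<ge> 3; distinct c; successively E c; E (last c) (hd c)\<rbrakk> \<Longrightarrow> False"
  using tree unfolding is_tree_def by (auto simp: symp_def irreflp_def)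

text \<open>
  Between two visits of one vertex that are as close in time as possible, the vertices are
  distinct. Absence of loops and of backtracking makes their number at least three, so they form
  a cycle.
\<close>

lemma reduced_walk_not_closed:
  assumes w: "reduced_walk E n w" and n: "n > 0"
  shows "w 0 \<noteq> w n"
proof
  assume eq: "w 0 = w n"
  define P where "P l \<longleftrightarrow> l > 0 \<and> (\<exists>i. i + l \<le> n \<and> w i = w (i + l))" for l
  have "P n" using eq n by (auto simp: P_def)
  then have "P (Least P)" and least: "\<And>l. P l \<Longrightarrow> Least P \<le> l"
    by (auto intro: LeastI Least_le)
  then obtain i l where l: "l = Least P" "l > 0" "i + l \<le> n" "w i = w (i + l)"
    by (auto simp: P_def)
  have inj: "w (i + a) \<noteq> w (i + b)" if "a < b" "b < l" for a b
  proof
    assume "w (i + a) = w (i + b)"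
    then have "P (b - a)" unfolding P_def using that l
      by (intro conjI exI[of _ "i + a"]) auto
    from least[OF this] show False using that l by simp
  qed
  have "l \<noteq> 1"
    using w l adj_irrefl by (auto simp: reduced_walk_def dest: spec[of _ i])
  moreover have "l \<noteq> 2"
    using w l by (auto simp: reduced_walk_def numeral_2_eq_2)
  ultimately have l3: "l \<ge> 3" using l by simp
  define c where "c = map (\<lambda>a. w (i + a)) [0..<l]"
  have "distinct c" unfolding c_def distinct_conv_nth
    using inj by (auto) (metis linorder_neqE_nat)
  moreover have "successively E c" unfolding c_def successively_conv_nth
    using w l by (auto simp: reduced_walk_def)
  moreover have "last c = w (i + l - 1)" "hd c = w i"
    using l3 by (auto simp: c_def last_map hd_map)
  moreover have "E (w (i + l - 1)) (w i)"
    using w l unfolding reduced_walk_def by (metis Suc_diff_1 add_gr_0 diff_less less_le_trans zero_less_one)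
  ultimately show False using no_cycle[of c] l3 by (auto simp: c_def)
qed

text \<open>
  Strip a common last edge as long as there is one. When the last edges differ, the first walk
  followed by the second one backwards is reduced and closed, which cannot happen in a tree.
\<close>

lemma reduced_walk_unique:
  assumes "reduced_walk E n w" "reduced_walk E m v" "w 0 = v 0" "w n = v m"
  shows "n = m \<and> (\<forall>i\<le>n. w i = v i)"
  using assms
proof (induction n arbitrary: m)
  case 0
  then show ?case using reduced_walk_not_closed[of m v] by (cases m) auto
next
  case (Suc n)
  show ?case
  proof (cases m)
    case 0
    then show ?thesis using reduced_walk_not_closed[OF Suc.prems(1)] Suc.prems by auto
  next
    case (Suc m')
    show ?thesis
    proof (cases "w n = v m'")
      case True
      have "n = m' \<and> (\<forall>i\<le>n. w i = v i)"
        using Suc.IH[of m'] Suc.prems True \<open>m = Suc m'\<close>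
          reduced_walk_mono[of E "Suc n" w n] reduced_walk_mono[of E "Suc m'" v m'] by simp
      then show ?thesis using Suc.prems \<open>m = Suc m'\<close> by (auto simp: le_Suc_eq)
    next
      case False
      \<comment> \<open>The first walk, followed by the second one traversed backwards.\<close>
      define u where "u i = (if i \<le> Suc n then w i else v (Suc n + Suc m' - i))" for i
      have u2: "u i = v (Suc n + Suc m' - i)" if "i \<ge> Suc n" for i
        using that Suc.prems Suc by (cases "i = Suc n") (auto simp: u_def)
      have v: "reduced_walk E (Suc m') v" and w: "reduced_walk E (Suc n) w"
        using Suc.prems Suc by auto
      have "reduced_walk E (Suc n + Suc m') u"
        unfolding reduced_walk_def
      proof (intro conjI allI impI)
        fix i assume i: "i < Suc n + Suc m'"
        show "E (u i) (u (Suc i))"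
        proof (cases "i < Suc n")
          case True
          then show ?thesis using w by (auto simp: u_def reduced_walk_def)
        next
          case False
          then have "Suc n + Suc m' - i = Suc (Suc n + Suc m' - Suc i)" "Suc n + Suc m' - Suc i < Suc m'"
            using i by auto
          with False show ?thesis using v adj_sym
            by (simp add: u2 reduced_walk_def del: add_Suc add_Suc_right diff_Suc_Suc)
        qed
      next
        fix i assume i: "Suc (Suc i) \<le> Suc n + Suc m'"
        consider "Suc (Suc i) \<le> Suc n" | "i = n" | "i \<ge> Suc n" by linarith
        then show "u i \<noteq> u (Suc (Suc i))"
        proof cases
          case 1
          then show ?thesis using w by (auto simp: u_def reduced_walk_def)
        next
          case 2
          then show ?thesis using False by (auto simp: u_def)
        next
          case 3
          then have "Suc n + Suc m' - i = Suc (Suc (Suc n + Suc m' - Suc (Suc i)))"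
             "Suc (Suc (Suc n + Suc m' - Suc (Suc i))) \<le> Suc m'"
            using i by auto
          with 3 show ?thesis using v
            by (simp add: u2 reduced_walk_def del: add_Suc add_Suc_right diff_Suc_Suc) metis
        qed
      qed
      from reduced_walk_not_closed[OF this] have False
        using Suc.prems by (auto simp: u_def)
      then show ?thesis ..
    qed
  qed
qed

lemma dist_walk: "(E ^^ graph_dist E x y) x y"
  unfolding graph_dist_def using connected[of x y] by (metis LeastI_ex rtranclp_imp_relpowp)

lemma dist_le: "(E ^^ n) x y \<Longrightarrow> graph_dist E x y \<le> n"
  unfolding graph_dist_def by (rule Least_le)

lemma dist_self [simp]: "graph_dist E x x = 0"
  using dist_le[of 0 x x] by simp

lemma adj_iff_dist: "E x y \<longleftrightarrow> graph_dist E x y = 1"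
proof
  assume "E x y"
  then have "graph_dist E x y \<le> 1" "x \<noteq> y" using dist_le[of 1 x y] adj_irrefl by auto
  moreover have "graph_dist E x y \<noteq> 0" using dist_walk[of x y] \<open>x \<noteq> y\<close> by (metis relpowp_0_E)
  ultimately show "graph_dist E x y = 1" by simp
next
  assume "graph_dist E x y = 1"
  then show "E x y" using dist_walk[of x y] by (simp add: relcompp_apply)
qed

text \<open>
  A shortest walk is reduced, since backtracking could be cut out; by uniqueness it is the given
  walk.
\<close>

lemma dist_reduced_walk:
  assumes "reduced_walk E n w"
  shows "graph_dist E (w 0) (w n) = n"
proof -
  let ?m = "graph_dist E (w 0) (w n)"
  obtain v where v: "v 0 = w 0" "v ?m = w n" "\<And>i. i < ?m \<Longrightarrow> E (v i) (v (Suc i))"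
    using dist_walk[of "w 0" "w n"] by (auto simp: relpowp_fun_conv)
  have "v i \<noteq> v (Suc (Suc i))" if i: "Suc (Suc i) \<le> ?m" for i
  proof
    assume eq: "v i = v (Suc (Suc i))"
    \<comment> \<open>Skipping the detour from step \<open>i\<close> to step \<open>i + 2\<close> gives a walk that is shorter than the distance.\<close>
    define u where "u j = (if j \<le> i then v j else v (Suc (Suc j)))" for j
    have u2: "u j = v (Suc (Suc j))" if "j \<ge> i" for j
      using that eq by (cases "j = i") (simp_all add: u_def)
    have "E (u j) (u (Suc j))" if j: "j < ?m - 2" for j
    proof (cases "j < i")
      case True
      then show ?thesis using v(3)[of j] i by (simp add: u_def)
    next
      case False
      then show ?thesis using v(3)[of "Suc (Suc j)"] j by (simp add: u2)
    qed
    moreover have "u 0 = w 0" "u (?m - 2) = w n"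
    proof -
      show "u 0 = w 0" using v(1) by (simp add: u_def)
      have "Suc (Suc (?m - 2)) = ?m" using i by simp
      then show "u (?m - 2) = w n" using u2[of "?m - 2"] i v(2) by simp
    qed
    ultimately have "(E ^^ (?m - 2)) (w 0) (w n)" unfolding relpowp_fun_conv by metis
    from dist_le[OF this] i show False by simp
  qed
  with v have "reduced_walk E ?m v" by (auto simp: reduced_walk_def)
  from reduced_walk_unique[OF assms this] v(1,2) show ?thesis by metis
qed

lemma ray_iff_reduced: "geodesic_ray E g \<longleftrightarrow> (\<forall>n. reduced_walk E n g)"
proof
  assume g: "geodesic_ray E g"
  have "E (g i) (g (Suc i))" for i
    using g[unfolded geodesic_ray_def, rule_format, of i "Suc i"] by (simp add: adj_iff_dist)
  moreover have "g i \<noteq> g (Suc (Suc i))" for i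
    using g[unfolded geodesic_ray_def, rule_format, of i "Suc (Suc i)"] by auto
  ultimately show "\<forall>n. reduced_walk E n g" by (auto simp: reduced_walk_def)
next
  assume g: "\<forall>n. reduced_walk E n g"
  show "geodesic_ray E g" unfolding geodesic_ray_def
  proof (intro allI impI)
    fix i j :: nat assume "i \<le> j"
    have "reduced_walk E (j - i) (\<lambda>k. g (i + k))"
      using g by (auto simp: reduced_walk_def)
    from dist_reduced_walk[OF this] \<open>i \<le> j\<close> show "graph_dist E (g i) (g j) = j - i" by simp
  qed
qed

lemma ray_inj: "geodesic_ray E g \<Longrightarrow> g i = g j \<Longrightarrow> i = j"
  unfolding geodesic_ray_def by (metis dist_self diff_is_0_eq le_antisym nat_le_linear)

lemma ray_shift: "geodesic_ray E g \<Longrightarrow> geodesic_ray E (\<lambda>n. g (Suc n))"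
  unfolding ray_iff_reduced by (auto simp: reduced_walk_def)

lemma ray_extend:
  assumes "geodesic_ray E g" "E y (g 0)" "y \<noteq> g 1"
  shows "geodesic_ray E (case_nat y g)"
  using assms unfolding ray_iff_reduced reduced_walk_def by (auto split: nat.split)

text \<open>
  The two ranges share arbitrarily late vertices, and up to a shared vertex both rays follow the
  unique reduced walk.
\<close>

lemma ray_unique:
  assumes "geodesic_ray E g" "geodesic_ray E h" "g 0 = h 0"
    and fin: "finite (sym_diff (range g) (range h))"
  shows "g = h"
proof
  fix n
  have inf: "infinite (g ` {n..})"
    using ray_inj[OF assms(1)] by (subst finite_image_iff) (auto simp: inj_on_def infinite_Ici)
  have "\<not> g ` {n..} \<subseteq> sym_diff (range g) (range h)"
    using inf fin by (metis finite_subset)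
  then obtain i j where ij: "i \<ge> n" "g i = h j" by auto
  have "\<forall>k\<le>i. g k = h k"
    using reduced_walk_unique[of i g j h] assms ij by (auto simp: ray_iff_reduced)
  with ij show "g n = h n" by simp
qed

end

locale tree_with_end = tree +
  fixes \<omega> :: "(nat \<Rightarrow> 'a) set"
  assumes end_mem: "\<omega> \<in> ends E"
begin

lemma end_ray: "g \<in> \<omega> \<Longrightarrow> geodesic_ray E g"
  using end_mem unfolding ends_def by (auto simp: quotient_def ray_equiv_def)

lemma end_equiv: "g \<in> \<omega> \<Longrightarrow> h \<in> \<omega> \<Longrightarrow> finite (sym_diff (range g) (range h))"
proof -
  obtain f where f: "\<omega> = ray_equiv E `` {f}"
    using end_mem unfolding ends_def quotient_def by auto
  assume "g \<in> \<omega>" "h \<in> \<omega>"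
  then have "finite (sym_diff (range f) (range g) \<union> sym_diff (range f) (range h))"
    using f by (auto simp: ray_equiv_def)
  then show ?thesis by (rule finite_subset[rotated]) auto
qed

lemma end_closed:
  assumes "g \<in> \<omega>" "geodesic_ray E h" "finite (sym_diff (range g) (range h))"
  shows "h \<in> \<omega>"
proof -
  obtain f where f: "\<omega> = ray_equiv E `` {f}"
    using end_mem unfolding ends_def quotient_def by auto
  have "finite (sym_diff (range f) (range g) \<union> sym_diff (range g) (range h))"
    using f assms by (auto simp: ray_equiv_def)
  then have "finite (sym_diff (range f) (range h))" by (rule finite_subset[rotated]) auto
  then show ?thesis using f assms by (auto simp: ray_equiv_def)
qed

lemma end_shift: "g \<in> \<omega> \<Longrightarrow> (\<lambda>n. g (Suc n)) \<in> \<omega>"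
proof (rule end_closed)
  assume "g \<in> \<omega>"
  have "range g = insert (g 0) (range (\<lambda>n. g (Suc n)))"
    by (subst UNIV_nat_eq) (auto simp: image_iff)
  then have "sym_diff (range g) (range (\<lambda>n. g (Suc n))) \<subseteq> {g 0}" by auto
  then show "finite (sym_diff (range g) (range (\<lambda>n. g (Suc n))))" by (rule finite_subset) simp
qed (auto intro: ray_shift end_ray)

lemma end_extend:
  assumes "g \<in> \<omega>" "E y (g 0)" "y \<noteq> g 1"
  shows "case_nat y g \<in> \<omega>"
proof (rule end_closed[OF assms(1)])
  have "range (case_nat y g) = insert y (range g)"
    by (subst UNIV_nat_eq) (auto simp: image_iff)
  then have "sym_diff (range g) (range (case_nat y g)) \<subseteq> {y}" by auto
  then show "finite (sym_diff (range g) (range (case_nat y g)))" by (rule finite_subset) simp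
qed (use assms in \<open>auto intro: ray_extend end_ray\<close>)

lemma end_unique: "g \<in> \<omega> \<Longrightarrow> h \<in> \<omega> \<Longrightarrow> g 0 = h 0 \<Longrightarrow> g = h"
  by (rule ray_unique) (simp_all only: end_ray end_equiv)

text \<open>
  The rays of the end are transported along edges: dropping the first vertex of a ray or
  putting a new one in front changes its range by one vertex only.
\<close>

lemma end_exists: "\<exists>g\<in>\<omega>. g 0 = x"
proof -
  have "\<omega> \<noteq> {}"
    using end_mem unfolding ends_def quotient_def ray_equiv_def by auto
  then obtain g where g: "g \<in> \<omega>" by auto
  from connected[of "g 0" x] show ?thesis
  proof (induction rule: rtranclp_induct)
    case base
    then show ?case using g by auto
  next
    case (step y z)
    then obtain h where h: "h \<in> \<omega>" "h 0 = y" by auto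
    show ?case
    proof (cases "z = h 1")
      case True
      then show ?thesis using end_shift[OF h(1)] by force
    next
      case False
      then show ?thesis using end_extend[OF h(1), of z] h step(2) adj_sym[OF step(2)]
        by (metis nat.case(1))
    qed
  qed
qed

lemma ray_to: "ray_to \<omega> x \<in> \<omega>" "ray_to \<omega> x 0 = x"
proof -
  have "\<exists>!g. g \<in> \<omega> \<and> g 0 = x" using end_exists[of x] end_unique by auto
  from theI'[OF this] show "ray_to \<omega> x \<in> \<omega>" "ray_to \<omega> x 0 = x" by (auto simp: ray_to_def)
qed

lemma ray_to_eqI: "g \<in> \<omega> \<Longrightarrow> g 0 = x \<Longrightarrow> ray_to \<omega> x = g"
  using end_unique ray_to by metis

definition parent :: "'a \<Rightarrow> 'a" where
  "parent x = ray_to \<omega> x 1"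

lemma ray_to_funpow: "ray_to \<omega> x n = (parent ^^ n) x"
proof (induction n arbitrary: x)
  case 0
  show ?case by (simp add: ray_to)
next
  case (Suc n)
  have "ray_to \<omega> (parent x) = (\<lambda>n. ray_to \<omega> x (Suc n))"
    by (rule ray_to_eqI) (auto simp: parent_def intro: end_shift ray_to)
  then show ?case using Suc[of "parent x"] by (metis funpow_Suc_right comp_apply)
qed

lemma adj_iff_parent: "E x y \<longleftrightarrow> parent x = y \<or> parent y = x"
proof -
  have adj: "E z (parent z)" for z
  proof -
    have "reduced_walk E 1 (ray_to \<omega> z)"
      using end_ray[OF ray_to(1)[of z]] by (simp add: ray_iff_reduced)
    then show ?thesis by (simp add: reduced_walk_def parent_def ray_to)
  qed
  have "parent y = x" if "E x y" "parent x \<noteq> y"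
  proof -
    have "ray_to \<omega> y = case_nat y (ray_to \<omega> x)"
      using that end_extend[OF ray_to(1)[of x], of y] adj_sym
      by (intro ray_to_eqI) (auto simp: parent_def ray_to)
    then show ?thesis by (simp add: parent_def ray_to)
  qed
  then show ?thesis using adj adj_sym by metis
qed

lemma parent_funpow_inj: "(parent ^^ i) x = (parent ^^ j) x \<Longrightarrow> i = j"
  using ray_inj[OF end_ray[OF ray_to(1)[of x]], of i j] by (simp add: ray_to_funpow)

lemma dist_parent_funpow: "graph_dist E x ((parent ^^ n) x) = n"
  using end_ray[OF ray_to(1)[of x]] unfolding geodesic_ray_def
  by (metis diff_zero le0 ray_to(2) ray_to_funpow)

lemma common_ancestor: "\<exists>i j. (parent ^^ i) x = (parent ^^ j) y"
proof (rule ccontr)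
  assume "\<not> ?thesis"
  then have "range (ray_to \<omega> x) \<subseteq> sym_diff (range (ray_to \<omega> x)) (range (ray_to \<omega> y))"
    by (auto simp: ray_to_funpow)
  moreover have "infinite (range (ray_to \<omega> x))"
    using ray_inj[OF end_ray[OF ray_to(1)[of x]]] by (subst finite_image_iff) (auto simp: inj_def)
  ultimately show False using end_equiv[OF ray_to(1) ray_to(1)] by (metis finite_subset)
qed

text \<open>
  Any common ancestor computes the Busemann function, not only the confluent: above the confluent
  both generation counts grow by the same amount.
\<close>

lemma busemann_eq:
  assumes "(parent ^^ i) x = (parent ^^ j) rt"
  shows "busemann E rt \<omega> x = int i - int j"
proof -
  define n where "n = (LEAST i. \<exists>j. (parent ^^ i) x = (parent ^^ j) rt)"
  have least: "n \<le> k" if "(parent ^^ k) x = (parent ^^ l) rt" for k l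
    unfolding n_def using that by (intro Least_le) auto
  have "\<exists>j. (parent ^^ n) x = (parent ^^ j) rt"
    unfolding n_def by (rule LeastI_ex) (rule common_ancestor)
  then obtain m where m: "(parent ^^ n) x = (parent ^^ m) rt" by auto
  define b where "b = (parent ^^ n) x"
  have fp: "(parent ^^ (k + n)) x = (parent ^^ k) b" "(parent ^^ (k + m)) rt = (parent ^^ k) b" for k
    by (auto simp: b_def funpow_add m)
  have above: "z = (parent ^^ (k - n)) b" "k \<ge> n"
    if "z = (parent ^^ k) x" "(parent ^^ k) x = (parent ^^ l) rt" for z k l
    using fp(1)[of "k - n"] least[OF that(2)] that by auto
  have R: "range (ray_to \<omega> y) = range (\<lambda>k. (parent ^^ k) y)" for y
    by (simp add: ray_to_funpow)
  have meet: "range (ray_to \<omega> x) \<inter> range (ray_to \<omega> rt) = range (ray_to \<omega> b)"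
    unfolding R
  proof (intro equalityI subsetI)
    fix z assume z: "z \<in> range (\<lambda>k. (parent ^^ k) x) \<inter> range (\<lambda>k. (parent ^^ k) rt)"
    obtain k where k: "z = (parent ^^ k) x" using IntD1[OF z] by (rule rangeE)
    obtain l where l: "z = (parent ^^ l) rt" using IntD2[OF z] by (rule rangeE)
    have "z = (parent ^^ (k - n)) b" by (rule above(1)[OF k trans[OF k[symmetric] l]])
    then show "z \<in> range (\<lambda>k. (parent ^^ k) b)" by (rule range_eqI)
  next
    fix z assume "z \<in> range (\<lambda>k. (parent ^^ k) b)"
    then obtain k where "z = (parent ^^ k) b" by (rule rangeE)
    then have "z = (parent ^^ (k + n)) x" "z = (parent ^^ (k + m)) rt" by (simp_all only: fp)
    then show "z \<in> range (\<lambda>k. (parent ^^ k) x) \<inter> range (\<lambda>k. (parent ^^ k) rt)"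
      by (intro IntI range_eqI)
  qed
  have conf: "confluent \<omega> x rt = b"
    unfolding confluent_def meet
  proof (rule the_equality)
    fix b' assume eq: "range (ray_to \<omega> b) = range (ray_to \<omega> b')"
    have self: "y \<in> range (ray_to \<omega> y)" for y
      by (rule range_eqI[of _ _ 0]) (simp add: ray_to)
    obtain k where k: "b' = (parent ^^ k) b"
      using self[of b', folded eq, unfolded R] by (rule rangeE)
    obtain l where l: "b = (parent ^^ l) b'"
      using self[of b, unfolded eq, unfolded R] by (rule rangeE)
    have "(parent ^^ (l + k)) b = (parent ^^ l) b'"
      unfolding k funpow_add by simp
    also have "\<dots> = (parent ^^ 0) b" using l by simp
    finally have "l + k = 0" by (rule parent_funpow_inj)
    with k show "b' = b" by simp
  qed simp
  have "busemann E rt \<omega> x = int n - int m"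
    unfolding busemann_def conf using dist_parent_funpow[of x n] dist_parent_funpow[of rt m]
    by (simp add: b_def m)
  moreover have "(parent ^^ (i - n + m)) rt = (parent ^^ j) rt"
    using above(1)[OF refl assms] fp(2)[of "i - n"] assms by metis
  moreover have "i \<ge> n" by (rule above(2)[OF refl assms])
  ultimately show ?thesis using parent_funpow_inj[of "i - n + m" rt j] by simp
qed

lemma busemann_parent: "busemann E rt \<omega> (parent x) = busemann E rt \<omega> x - 1"
proof -
  obtain i j where ij: "(parent ^^ i) x = (parent ^^ j) rt" using common_ancestor by blast
  then have "(parent ^^ i) (parent x) = (parent ^^ Suc j) rt"
    by (metis funpow.simps(2) funpow_swap1 comp_apply)
  from busemann_eq[OF ij] busemann_eq[OF this] show ?thesis by simp
qed

lemma busemann_root [simp]: "busemann E rt \<omega> rt = 0"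
  using busemann_eq[of 0 rt 0 rt] by simp

lemma parent_asym: "parent x = y \<Longrightarrow> parent y \<noteq> x"
  using busemann_parent[of x x] busemann_parent[of x y] by auto

lemma card_children:
  assumes "card {y. E x y} = Suc p"
  shows "card {y. parent y = x} = p" "finite {y. parent y = x}"
proof -
  have fin: "finite {y. E x y}" using assms by (metis card.infinite nat.distinct(1))
  have eq: "{y. E x y} = insert (parent x) {y. parent y = x}" by (auto simp: adj_iff_parent)
  then show f: "finite {y. parent y = x}" using fin by simp
  have "parent x \<notin> {y. parent y = x}" using parent_asym[of x "parent x"] by auto
  then show "card {y. parent y = x} = p" using assms eq f by simp
qed

end

section \<open>Closed walks with a prescribed height profile\<close>

text \<open>
  Height profiles are lists with the most recent step first. \<open>True\<close> moves the first coordinate to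
  its parent and the second one to a child, \<open>False\<close> does the opposite; \<open>pos\<close> is therefore minus the
  Busemann function of the first coordinate. The second tree sees the profile with all steps
  negated.
\<close>

fun pos :: "bool list \<Rightarrow> int" where
  "pos [] = 0"
| "pos (b # s) = pos s + (if b then 1 else - 1)"

text \<open>
  The highest level above the root that the profile reaches in the first tree.
\<close>

fun peak :: "bool list \<Rightarrow> nat" where
  "peak [] = 0"
| "peak (b # s) = max (peak s) (nat (pos (b # s)))"

lemma pos_le_peak: "pos s \<le> int (peak s)"
  by (cases s) auto

lemma peak_le_count: "peak s \<le> count_list s True"
  and pos_le_count: "pos s \<le> int (count_list s True)"
  by (induction s) auto

lemma pos_eq_count: "pos s = int (count_list s True) - int (count_list s False)"
  by (induction s) auto

lemma length_eq_count: "length s = count_list s True + count_list s False"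
  by (induction s) auto

lemma pos_map_Not: "pos (map Not s) = - pos s"
  by (induction s) auto

lemma count_list_map_Not: "count_list (map Not s) True = count_list s False"
  by (induction s) auto

lemma lists_Suc:
  "{s :: bool list. length s = Suc n} = (#) True ` {s. length s = n} \<union> (#) False ` {s. length s = n}"
proof -
  have "s \<in> (#) True ` {s. length s = n} \<union> (#) False ` {s. length s = n}"
    if "length s = Suc n" for s :: "bool list"
    using that by (cases s) auto
  then show ?thesis by auto
qed

lemma finite_bool_lists [simp]: "finite {s :: bool list. length s = n}"
  using finite_lists_length_eq[of "UNIV :: bool set" n] by simp

lemma sum_lists_Suc:
  "(\<Sum>s | length s = Suc n. f s) = (\<Sum>s | length s = n. f (True # s)) + (\<Sum>s | length s = n. f (False # s))"
  for f :: "bool list \<Rightarrow> 'c :: comm_monoid_add"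
  unfolding lists_Suc
  by (subst sum.union_disjoint) (auto simp: sum.reindex)

text \<open>
  The number of walks in a single tree from \<open>rt\<close> to \<open>x\<close> with a given profile, by recursion on
  the last step.
\<close>

fun profile_walks :: "('a \<Rightarrow> 'a) \<Rightarrow> 'a \<Rightarrow> bool list \<Rightarrow> 'a \<Rightarrow> nat" where
  "profile_walks par rt [] x = (if x = rt then 1 else 0)"
| "profile_walks par rt (True # s) x = (\<Sum>y | par y = x. profile_walks par rt s y)"
| "profile_walks par rt (False # s) x = profile_walks par rt s (par x)"

text \<open>
  The walk is confined to the descendants of the highest ancestor it has visited, which is
  the ancestor of the root \<open>peak s\<close> generations up, and reaches all descendants of this ancestor at
  the final level equally often. Only a step to a new highest level changes the set of reachable
  vertices; there a single child carries the count.
\<close>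

lemma profile_walks_eq:
  assumes card: "\<And>x. card {y. par y = x} = p" and fin: "\<And>x. finite {y. par y = x}"
  shows "profile_walks par rt s x =
    (if (par ^^ nat (int (peak s) - pos s)) x = (par ^^ peak s) rt
     then p ^ (count_list s True - peak s) else 0)"
proof (induction s arbitrary: x)
  case Nil
  show ?case by simp
next
  case (Cons b s)
  have le: "pos s \<le> int (peak s)" "peak s \<le> count_list s True" by (rule pos_le_peak, rule peak_le_count)
  consider (new) "b" "pos s = int (peak s)" | (old) "b" "pos s < int (peak s)" | (down) "\<not> b"
    using le by fastforce
  then show ?case
  proof cases
    case new
    have "profile_walks par rt (b # s) x =
        (\<Sum>y | par y = x. if y = (par ^^ peak s) rt then p ^ (count_list s True - peak s) else 0)"
      using new by (simp add: Cons)
    also have "\<dots> = (if par ((par ^^ peak s) rt) = x then p ^ (count_list s True - peak s) else 0)"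
      using fin[of x] by (subst sum.delta) auto
    finally show ?thesis using new by (auto simp: nat_add_distrib max_def)
  next
    case old
    define d where "d = nat (int (peak s) - (pos s + 1))"
    have d: "nat (int (peak s) - pos s) = Suc d" using old by (simp add: d_def)
    have "peak (b # s) = peak s" using old by simp
    moreover have "profile_walks par rt (b # s) x =
        (\<Sum>y | par y = x. if (par ^^ d) x = (par ^^ peak s) rt then p ^ (count_list s True - peak s) else 0)"
      unfolding \<open>b\<close>[THEN eqTrueI] profile_walks.simps
      by (intro sum.cong refl) (simp add: Cons d funpow_Suc_right del: funpow.simps)
    ultimately show ?thesis
      using old le card[of x] by (simp add: d_def Suc_diff_le)
  next
    case down
    have "peak (b # s) = peak s" using down le by simp
    moreover have "nat (int (peak s) - (pos s - 1)) = Suc (nat (int (peak s) - pos s))" using le by simp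
    ultimately show ?thesis
      using down Cons[of "par x"] by (simp add: funpow_Suc_right del: funpow.simps)
  qed
qed

locale diestel_leader =
  T1: tree_with_end E1 \<omega>1 + T2: tree_with_end E2 \<omega>2
  for E1 :: "'a \<Rightarrow> 'a \<Rightarrow> bool" and \<omega>1 and E2 :: "'b \<Rightarrow> 'b \<Rightarrow> bool" and \<omega>2 +
  fixes q r :: nat and o1 :: 'a and o2 :: 'b
  assumes deg1: "card {y. E1 x y} = q + 1" and deg2: "card {y. E2 x' y} = r + 1"
    and q_pos: "q > 0"
begin

abbreviation "verts \<equiv> DL_verts E1 o1 \<omega>1 E2 o2 \<omega>2"
abbreviation "nbrs \<equiv> DL_nbrs E1 o1 \<omega>1 E2 o2 \<omega>2"

lemma children:
  "card {y. T1.parent y = x} = q" "finite {y. T1.parent y = x}"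
  "card {y. T2.parent y = x'} = r" "finite {y. T2.parent y = x'}"
  using T1.card_children[of x q] T2.card_children[of x' r] deg1 deg2 by auto

lemma nbrs_eq:
  assumes "x \<in> verts"
  shows "nbrs x = Pair (T1.parent (fst x)) ` {y. T2.parent y = snd x} \<union>
                  (\<lambda>y. (y, T2.parent (snd x))) ` {y. T1.parent y = fst x}"
proof -
  have b1: "busemann E1 o1 \<omega>1 y = busemann E1 o1 \<omega>1 x + 1" if "T1.parent y = x" for x y
    using T1.busemann_parent[of o1 y] that by simp
  have b2: "busemann E2 o2 \<omega>2 y = busemann E2 o2 \<omega>2 x + 1" if "T2.parent y = x" for x y
    using T2.busemann_parent[of o2 y] that by simp
  have "(y1, y2) \<in> nbrs x \<longleftrightarrow> y1 = T1.parent (fst x) \<and> T2.parent y2 = snd x \<or>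
          y2 = T2.parent (snd x) \<and> T1.parent y1 = fst x" for y1 y2
    using assms b1[of y1 "fst x"] b1[of "fst x" y1] b2[of y2 "snd x"] b2[of "snd x" y2]
    by (auto simp: DL_nbrs_def DL_verts_def T1.adj_iff_parent T2.adj_iff_parent)
  then show ?thesis by (auto simp: image_iff)
qed

lemma sum_nbrs:
  fixes f :: "'a \<times> 'b \<Rightarrow> real"
  assumes "x \<in> verts"
  shows "sum f (nbrs x) = (\<Sum>y | T2.parent y = snd x. f (T1.parent (fst x), y)) +
                          (\<Sum>y | T1.parent y = fst x. f (y, T2.parent (snd x)))"
proof -
  have "(T1.parent (fst x), y) \<noteq> (y', T2.parent (snd x))" if "T1.parent y' = fst x" for y y'
    using T1.parent_asym[of "fst x" y'] that by auto
  then show ?thesis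
    unfolding nbrs_eq[OF assms]
    by (subst sum.union_disjoint) (auto simp: children sum.reindex inj_on_def)
qed

lemma finite_nbrs: "x \<in> verts \<Longrightarrow> finite (nbrs x)"
  by (simp add: nbrs_eq children)

lemma card_nbrs: "x \<in> verts \<Longrightarrow> card (nbrs x) = q + r"
  using sum_nbrs[of x "\<lambda>_. 1"] by (simp add: children)

lemma nbrs_nonempty: "x \<in> verts \<Longrightarrow> nbrs x \<noteq> {}"
  using card_nbrs[of x] q_pos by auto

lemma nbrs_sym: "x \<in> verts \<Longrightarrow> y \<in> verts \<Longrightarrow> x \<in> nbrs y \<longleftrightarrow> y \<in> nbrs x"
  using T1.adj_sym T2.adj_sym by (auto simp: DL_nbrs_def)

lemma root_in_verts: "(o1, o2) \<in> verts"
  by (simp add: DL_verts_def)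

abbreviation "walk N \<equiv> DL_walk E1 o1 \<omega>1 E2 o2 \<omega>2 N (o1, o2)"

lemma walk_0: "walk 0 = return_pmf (o1, o2)"
  and walk_Suc: "walk (Suc N) = bind_pmf (walk N) (\<lambda>y. pmf_of_set (nbrs y))"
  by (simp_all add: DL_walk_def)

lemma set_walk: "set_pmf (walk N) \<subseteq> verts"
proof (induction N)
  case 0
  show ?case by (simp add: walk_0 root_in_verts)
next
  case (Suc N)
  have "set_pmf (pmf_of_set (nbrs y)) \<subseteq> verts" if "y \<in> verts" for y
    using that by (simp add: set_pmf_of_set[OF nbrs_nonempty finite_nbrs]) (auto simp: DL_nbrs_def)
  with Suc show ?case by (auto simp: walk_Suc)
qed

lemma pmf_walk_Suc:
  assumes x: "x \<in> verts"
  shows "pmf (walk (Suc N)) x = (\<Sum>y\<in>nbrs x. pmf (walk N) y) / real (q + r)"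
proof -
  have "pmf (walk (Suc N)) x = (\<integral>y. pmf (pmf_of_set (nbrs y)) x \<partial>measure_pmf (walk N))"
    by (simp add: walk_Suc pmf_bind)
  also have "\<dots> = (\<integral>y. indicator (nbrs x) y / real (q + r) \<partial>measure_pmf (walk N))"
  proof (intro Bochner_Integration.integral_cong_AE)
    show "AE y in measure_pmf (walk N). pmf (pmf_of_set (nbrs y)) x = indicator (nbrs x) y / real (q + r)"
    proof (rule AE_pmfI)
      fix y assume "y \<in> set_pmf (walk N)"
      then have y: "y \<in> verts" using set_walk by auto
      then show "pmf (pmf_of_set (nbrs y)) x = indicator (nbrs x) y / real (q + r)"
        using nbrs_sym[OF x y]
        by (simp add: pmf_of_set[OF nbrs_nonempty finite_nbrs] card_nbrs indicator_def)
    qed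
  qed auto
  also have "\<dots> = measure (measure_pmf (walk N)) (nbrs x) / real (q + r)" by simp
  finally show ?thesis by (simp add: measure_measure_pmf_finite finite_nbrs x)
qed

abbreviation "w1 \<equiv> profile_walks T1.parent o1"
abbreviation "w2 s \<equiv> profile_walks T2.parent o2 (map Not s)"

text \<open>
  Given the profile, the choices of children in the two trees are independent; hence the
  product.
\<close>

lemma pmf_walk:
  "x \<in> verts \<Longrightarrow> pmf (walk N) x =
     (\<Sum>s | length s = N. real (w1 s (fst x)) * real (w2 s (snd x))) / real (q + r) ^ N"
proof (induction N arbitrary: x)
  case 0
  show ?case by (cases x) (auto simp: walk_0 indicator_def)
next
  case (Suc N)
  let ?g = "\<lambda>s y. real (w1 s (fst y)) * real (w2 s (snd y))"
  have "(\<Sum>y\<in>nbrs x. pmf (walk N) y) =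
          (\<Sum>y\<in>nbrs x. (\<Sum>s | length s = N. ?g s y) / real (q + r) ^ N)"
    by (intro sum.cong refl Suc.IH) (auto simp: DL_nbrs_def)
  also have "\<dots> = (\<Sum>s | length s = N. \<Sum>y\<in>nbrs x. ?g s y) / real (q + r) ^ N"
    by (subst sum.swap) (simp add: sum_divide_distrib)
  also have "(\<Sum>s | length s = N. \<Sum>y\<in>nbrs x. ?g s y) = (\<Sum>s | length s = Suc N. ?g s x)"
    unfolding sum_lists_Suc sum_nbrs[OF Suc.prems]
    by (simp add: sum.distrib sum_distrib_left sum_distrib_right add.commute)
  finally show ?case
    using pmf_walk_Suc[OF Suc.prems, of N] by (simp add: field_simps)
qed

lemma w1_root: "w1 s o1 = (if pos s = 0 then q ^ (count_list s True - peak s) else 0)"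
proof -
  have "(T1.parent ^^ nat (int (peak s) - pos s)) o1 = (T1.parent ^^ peak s) o1 \<longleftrightarrow> pos s = 0"
    using T1.parent_funpow_inj[of "nat (int (peak s) - pos s)" o1 "peak s"] pos_le_peak[of s] by auto
  then show ?thesis by (simp add: profile_walks_eq[where p = q] children)
qed

lemma w2_root:
  "w2 s o2 = (if pos s = 0 then r ^ (count_list s False - peak (map Not s)) else 0)"
proof -
  have "(T2.parent ^^ nat (int (peak (map Not s)) - pos (map Not s))) o2 =
          (T2.parent ^^ peak (map Not s)) o2 \<longleftrightarrow> pos s = 0"
    using T2.parent_funpow_inj[of "nat (int (peak (map Not s)) - pos (map Not s))" o2 "peak (map Not s)"]
      pos_le_peak[of "map Not s"] by (auto simp: pos_map_Not)
  then show ?thesis by (simp add: profile_walks_eq[where p = r] children count_list_map_Not)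
qed

text \<open>
  A profile returns to the level of the root iff it has \<open>N\<close> steps of either kind, and then the
  ancestor condition in \<open>profile_walks_eq\<close> holds at the root automatically.
\<close>

lemma return_probability_sum:
  "DL_prob E1 o1 \<omega>1 E2 o2 \<omega>2 (2 * N) (o1, o2) (o1, o2) =
     (\<Sum>s | length s = 2 * N \<and> pos s = 0. real q ^ (N - peak s) * real r ^ (N - peak (map Not s)))
       / real (q + r) ^ (2 * N)"
proof -
  have "(\<Sum>s | length s = 2 * N. real (w1 s o1) * real (w2 s o2)) =
      (\<Sum>s | length s = 2 * N \<and> pos s = 0. real (w1 s o1) * real (w2 s o2))"
    by (intro sum.mono_neutral_right) (auto simp: w1_root)
  also have "\<dots> = (\<Sum>s | length s = 2 * N \<and> pos s = 0. real q ^ (N - peak s) * real r ^ (N - peak (map Not s)))"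
  proof (intro sum.cong refl)
    fix s assume "s \<in> {s. length s = 2 * N \<and> pos s = 0}"
    then have "count_list s True = N" "count_list s False = N" "pos s = 0"
      using pos_eq_count[of s] length_eq_count[of s] by auto
    then show "real (w1 s o1) * real (w2 s o2) = real q ^ (N - peak s) * real r ^ (N - peak (map Not s))"
      unfolding w1_root w2_root by simp
  qed
  finally show ?thesis
    unfolding DL_prob_def pmf_walk[OF root_in_verts] by simp
qed

end

section \<open>Bridges in a strip and the cosine modes\<close>

text \<open>
  Multiplication by twice the sine of half the frequency makes the sum telescope.
\<close>

lemma sum_cos_closed:
  assumes "n \<noteq> 0" "\<bar>n\<bar> < 2 * int k"
  shows "(\<Sum>j<k. cos (pi * real j * of_int n / real k)) = (1 - cos (pi * of_int n)) / 2"
proof -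
  define \<theta> where "\<theta> = pi * of_int n / real k"
  have k: "k > 0" using assms by (cases k) auto
  have nz: "sin (\<theta> / 2) \<noteq> 0"
  proof
    assume "sin (\<theta> / 2) = 0"
    then obtain i :: int where "\<theta> / 2 = of_int i * pi" by (auto simp: sin_zero_iff_int2)
    then have "of_int n = (of_int (2 * int k * i) :: real)" using k by (simp add: \<theta>_def field_simps)
    then have "n = 2 * int k * i" by linarith
    with assms show False by (auto simp: abs_mult)
  qed
  have tele: "2 * sin (\<theta> / 2) * (\<Sum>j<m. cos (real j * \<theta>)) = sin ((real m - 1 / 2) * \<theta>) + sin (\<theta> / 2)" for m
  proof (induction m)
    case (Suc m)
    have "2 * sin (\<theta> / 2) * cos (real m * \<theta>) = sin ((real m + 1 / 2) * \<theta>) - sin ((real m - 1 / 2) * \<theta>)"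
      by (simp add: sin_add sin_diff algebra_simps)
    with Suc show ?case by (simp add: algebra_simps)
  qed simp
  have "(real k - 1 / 2) * \<theta> = pi * of_int n - \<theta> / 2" using k by (simp add: \<theta>_def field_simps)
  then have "sin ((real k - 1 / 2) * \<theta>) = - (cos (pi * of_int n) * sin (\<theta> / 2))"
    by (simp add: sin_diff sin_npi_int)
  with tele[of k] have "2 * sin (\<theta> / 2) * (\<Sum>j<k. cos (real j * \<theta>)) =
      2 * sin (\<theta> / 2) * ((1 - cos (pi * of_int n)) / 2)" by (simp add: algebra_simps)
  then have "(\<Sum>j<k. cos (real j * \<theta>)) = (1 - cos (pi * of_int n)) / 2" using nz by simp
  then show ?thesis by (simp add: \<theta>_def mult_ac)
qed

text \<open>
  The cosine sums for the frequencies \<open>a - c\<close> and \<open>a + c\<close> depend on the parity of the frequency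
  only, and both have the same parity; they cancel unless \<open>a - c\<close> vanishes.
\<close>

lemma sin_orthogonal:
  assumes a: "0 < a" "a < int k" and c: "0 < c" "c < int k"
  shows "(\<Sum>j<k. sin (pi * real j * of_int a / real k) * sin (pi * real j * of_int c / real k)) =
           (if a = c then real k / 2 else 0)"
proof -
  let ?C = "\<lambda>n. \<Sum>j<k. cos (pi * real j * of_int n / real k)"
  have "(\<Sum>j<k. sin (pi * real j * of_int a / real k) * sin (pi * real j * of_int c / real k)) =
      (\<Sum>j<k. (cos (pi * real j * of_int (a - c) / real k) - cos (pi * real j * of_int (a + c) / real k)) / 2)"
    by (intro sum.cong refl)
       (simp add: sin_times_sin algebra_simps diff_divide_distrib add_divide_distrib)
  also have "\<dots> = (?C (a - c) - ?C (a + c)) / 2"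
    by (simp only: sum_subtractf[symmetric] sum_divide_distrib)
  also have "?C (a + c) = (1 - cos (pi * of_int (a + c))) / 2"
    using assms by (intro sum_cos_closed) auto
  also have "cos (pi * of_int (a + c)) = cos (pi * of_int (a - c))"
    unfolding cos_npi_int by simp
  also have "(?C (a - c) - (1 - cos (pi * of_int (a - c))) / 2) / 2 = (if a = c then real k / 2 else 0)"
    using assms by (cases "a = c") (simp_all only: sum_cos_closed, auto)
  finally show ?thesis .
qed

definition strip_paths :: "nat \<Rightarrow> nat \<Rightarrow> nat \<Rightarrow> int \<Rightarrow> bool list set" where
  "strip_paths M a b x = {s. length s = M \<and> pos s = x \<and> peak s \<le> a \<and> peak (map Not s) \<le> b}"

lemma card_strip_paths_Suc:
  "card (strip_paths (Suc M) a b x) =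
     (if - int b \<le> x \<and> x \<le> int a
      then card (strip_paths M a b (x - 1)) + card (strip_paths M a b (x + 1)) else 0)"
proof -
  have fin: "finite (strip_paths M a b y)" for y
    by (rule finite_subset[OF _ finite_bool_lists[of M]]) (auto simp: strip_paths_def)
  have mem: "c # s \<in> strip_paths (Suc M) a b x \<longleftrightarrow>
      - int b \<le> x \<and> x \<le> int a \<and> s \<in> strip_paths M a b (if c then x - 1 else x + 1)" for c s
    by (auto simp: strip_paths_def pos_map_Not)
  show ?thesis
  proof (cases "- int b \<le> x \<and> x \<le> int a")
    case True
    have eq: "strip_paths (Suc M) a b x =
        (#) True ` strip_paths M a b (x - 1) \<union> (#) False ` strip_paths M a b (x + 1)"
    proof (intro set_eqI iffI)
      fix s assume s: "s \<in> strip_paths (Suc M) a b x"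
      then obtain c s' where "s = c # s'" by (cases s) (auto simp: strip_paths_def)
      with s True mem[of c s'] show "s \<in> (#) True ` strip_paths M a b (x - 1) \<union> (#) False ` strip_paths M a b (x + 1)"
        by (cases c) auto
    next
      fix s assume "s \<in> (#) True ` strip_paths M a b (x - 1) \<union> (#) False ` strip_paths M a b (x + 1)"
      then show "s \<in> strip_paths (Suc M) a b x" using True mem by auto
    qed
    show ?thesis unfolding eq using True fin
      by (subst card_Un_disjoint) (auto simp: card_image)
  next
    case False
    have "s \<notin> strip_paths (Suc M) a b x" for s
      using False mem[of "hd s" "tl s"] by (cases s) (auto simp: strip_paths_def)
    then have "strip_paths (Suc M) a b x = {}" by blast
    then show ?thesis unfolding if_not_P[OF False] by simp
  qed
qed

text \<open>
  Both sides satisfy the same recursion in the number of steps: on the right this is the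
  addition theorem, together with the sines vanishing one step outside of the strip. At time zero
  they agree by orthogonality. The bounds on \<open>x\<close> include these two outer levels because the
  recursion refers to them.
\<close>

lemma card_strip_paths:
  assumes "- int b - 1 \<le> x" "x \<le> int a + 1"
  shows "real (card (strip_paths M a b x)) =
    2 / real (a + b + 2) * (\<Sum>j<a + b + 2. sin (pi * real j * of_int (int a + 1) / real (a + b + 2)) *
      sin (pi * real j * of_int (int a + 1 - x) / real (a + b + 2)) * (2 * cos (pi * real j / real (a + b + 2))) ^ M)"
  using assms
proof (induction M arbitrary: x)
  case 0
  let ?k = "a + b + 2"
  have "strip_paths 0 a b x = (if x = 0 then {[]} else {})"
    by (auto simp: strip_paths_def)
  then have card: "real (card (strip_paths 0 a b x)) = (if x = 0 then 1 else 0)" by simp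
  consider "x = int a + 1" | "x = - int b - 1" | "- int b \<le> x" "x \<le> int a" using 0 by linarith
  then show ?case
  proof cases
    case 1
    then show ?thesis unfolding card by simp
  next
    case 2
    have z: "sin (pi * real j * of_int (int a + 1 - x) / real ?k) = 0" for j
    proof -
      have "pi * real j * of_int (int a + 1 - x) / real ?k = real j * pi"
      proof -
        have "real_of_int (int a + 1 - x) = real ?k" using 2 by simp
        then show ?thesis by (simp only:) simp
      qed
      then show ?thesis by (simp only: sin_npi)
    qed
    have "x \<noteq> 0" using 2 by simp
    then show ?thesis unfolding card z by simp
  next
    case 3
    then have "(\<Sum>j<?k. sin (pi * real j * of_int (int a + 1) / real ?k) *
        sin (pi * real j * of_int (int a + 1 - x) / real ?k)) = (if int a + 1 = int a + 1 - x then real ?k / 2 else 0)"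
      by (intro sin_orthogonal) auto
    then show ?thesis unfolding card by (simp only: power_0 mult_1_right) simp
  qed
next
  case (Suc M)
  let ?k = "a + b + 2"
  let ?s = "\<lambda>j x. sin (pi * real j * of_int (int a + 1 - x) / real ?k)"
  let ?A = "\<lambda>j. sin (pi * real j * of_int (int a + 1) / real ?k)"
  let ?c = "\<lambda>j. 2 * cos (pi * real j / real ?k)"
  show ?case
  proof (cases "- int b \<le> x \<and> x \<le> int a")
    case False
    then consider "x = int a + 1" | "x = - int b - 1" using Suc.prems by linarith
    then have "?s j x = 0" for j
    proof cases
      case 2
      have "pi * real j * of_int (int a + 1 - x) / real ?k = real j * pi"
      proof -
        have "real_of_int (int a + 1 - x) = real ?k" using 2 by simp
        then show ?thesis by (simp only:) simp
      qed
      then show ?thesis by (simp only: sin_npi)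
    qed simp
    then show ?thesis using False by (simp only: card_strip_paths_Suc if_False) simp
  next
    case True
    have trig: "?s j (x - 1) + ?s j (x + 1) = ?c j * ?s j x" for j
    proof -
      have e: "pi * real j * of_int (int a + 1 - (x - 1)) / real ?k =
              pi * real j * of_int (int a + 1 - x) / real ?k + pi * real j / real ?k"
        "pi * real j * of_int (int a + 1 - (x + 1)) / real ?k =
              pi * real j * of_int (int a + 1 - x) / real ?k - pi * real j / real ?k"
        by (simp_all add: algebra_simps add_divide_distrib diff_divide_distrib)
      show ?thesis unfolding e sin_add sin_diff by simp
    qed
    have "real (card (strip_paths (Suc M) a b x)) =
        real (card (strip_paths M a b (x - 1))) + real (card (strip_paths M a b (x + 1)))"
      using True by (simp add: card_strip_paths_Suc)
    also have "\<dots> = 2 / real ?k * (\<Sum>j<?k. ?A j * ?s j (x - 1) * ?c j ^ M)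
                  + 2 / real ?k * (\<Sum>j<?k. ?A j * ?s j (x + 1) * ?c j ^ M)"
      using True by (intro arg_cong2[where f = "(+)"] Suc.IH) auto
    also have "\<dots> = 2 / real ?k * (\<Sum>j<?k. ?A j * (?s j (x - 1) + ?s j (x + 1)) * ?c j ^ M)"
      by (simp only: distrib_left[symmetric] sum.distrib[symmetric] distrib_right[symmetric])
    also have "\<dots> = 2 / real ?k * (\<Sum>j<?k. ?A j * ?s j x * ?c j ^ Suc M)"
      unfolding trig by (simp only: power_Suc mult_ac)
    finally show ?thesis .
  qed
qed

lemma geometric_tail_sums:
  fixes x :: real
  assumes "0 \<le> x" "x < 1"
  shows "(\<lambda>i. x ^ i * of_bool (m \<le> i)) sums (x ^ m / (1 - x))"
proof -
  have "(\<lambda>i. x ^ m * x ^ i) sums (x ^ m * (1 / (1 - x)))"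
    using assms by (intro sums_mult geometric_sums) auto
  then have "(\<lambda>i. x ^ (i + m) * of_bool (m \<le> i + m)) sums (x ^ m / (1 - x))"
    by (simp add: power_add mult_ac)
  moreover have "(\<Sum>i<m. x ^ i * of_bool (m \<le> i)) = 0" by (intro sum.neutral) auto
  ultimately show ?thesis by (subst (asm) sums_iff_shift) simp
qed

text \<open>
  The exponent is \<open>b - 1\<close> because \<open>b\<close> is the distance of the root from the outside of the strip,
  which is one more than the extremum allowed on that side. The mode \<open>j = 0\<close> contributes nothing
  and is kept to have initial segments as index sets.
\<close>

definition mode_weight :: "real \<Rightarrow> nat \<Rightarrow> nat \<Rightarrow> real" where
  "mode_weight z k j = (\<Sum>b\<in>{1..<k}. z ^ (b - 1) * (sin (pi * real j * real b / real k))\<^sup>2)"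

text \<open>
  Reflecting the strip, \<open>i\<close> to \<open>K - i\<close>, leaves the squared sines unchanged; this allows
  \<open>x ^ K\<close> to be pulled out, after which only the quotient \<open>y / x\<close> remains.
\<close>

lemma strip_sum:
  fixes x y :: real
  assumes "x > 0"
  shows "(\<Sum>i\<le>K. x ^ i * y ^ (K - i) * real (card (strip_paths (2 * N) i (K - i) 0))) =
     4 ^ N * x ^ K * (2 / real (K + 2) *
       (\<Sum>j<K + 2. mode_weight (y / x) (K + 2) j * cos (pi * real j / real (K + 2)) ^ (2 * N)))"
proof -
  let ?k = "K + 2"
  let ?s = "\<lambda>j i. (sin (pi * real j * real (i + 1) / real ?k))\<^sup>2"
  have mirror: "?s j (K - i) = ?s j i" if "i \<le> K" for i j
  proof -
    have "pi * real j * real (K - i + 1) / real ?k = real j * pi - pi * real j * real (i + 1) / real ?k"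
      using that by (simp add: field_simps of_nat_diff)
    then show ?thesis by (simp only: sin_diff sin_npi cos_npi) (simp add: power_mult_distrib flip: power_mult)
  qed
  have w: "x ^ K * mode_weight (y / x) ?k j = (\<Sum>i\<le>K. x ^ i * y ^ (K - i) * ?s j i)" for j
  proof -
    have rev: "(\<Sum>i\<le>K. f i) = (\<Sum>i\<le>K. f (K - i))" for f :: "nat \<Rightarrow> real"
      by (rule sum.reindex_bij_witness[of _ "\<lambda>i. K - i" "\<lambda>i. K - i"]) auto
    have "(\<Sum>i\<le>K. x ^ i * y ^ (K - i) * ?s j i) = (\<Sum>i\<le>K. x ^ (K - i) * y ^ i * ?s j i)"
      by (subst rev, intro sum.cong) (simp_all only: mirror atMost_iff diff_diff_cancel)
    also have "\<dots> = (\<Sum>i\<le>K. x ^ K * ((y / x) ^ i * ?s j i))"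
      using assms by (intro sum.cong) (auto simp: power_diff power_divide)
    also have "\<dots> = x ^ K * (\<Sum>b\<in>{1..<?k}. (y / x) ^ (b - 1) * ?s j (b - 1))"
      unfolding sum_distrib_left
      by (rule sum.reindex_bij_witness[of _ "\<lambda>b. b - 1" "\<lambda>i. i + 1"]) auto
    also have "(\<Sum>b\<in>{1..<?k}. (y / x) ^ (b - 1) * ?s j (b - 1)) = mode_weight (y / x) ?k j"
      unfolding mode_weight_def by (intro sum.cong) auto
    finally show ?thesis by simp
  qed
  have "(\<Sum>i\<le>K. x ^ i * y ^ (K - i) * real (card (strip_paths (2 * N) i (K - i) 0))) =
    (\<Sum>i\<le>K. x ^ i * y ^ (K - i) * (2 / real ?k * (\<Sum>j<?k. ?s j i * (2 * cos (pi * real j / real ?k)) ^ (2 * N))))"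
  proof (intro sum.cong refl arg_cong2[where f = "(*)"])
    fix i assume "i \<in> {..K}"
    then have k: "i + (K - i) + 2 = ?k" by simp
    have e: "real_of_int (int i + 1) = real (i + 1)" by simp
    show "real (card (strip_paths (2 * N) i (K - i) 0)) =
        2 / real ?k * (\<Sum>j<?k. ?s j i * (2 * cos (pi * real j / real ?k)) ^ (2 * N))"
      using card_strip_paths[of "K - i" 0 i "2 * N"] unfolding k
      by (simp only: diff_zero e power2_eq_square)
  qed
  also have "\<dots> = (\<Sum>i\<le>K. \<Sum>j<?k. 2 / real ?k * ((x ^ i * y ^ (K - i) * ?s j i) * (2 * cos (pi * real j / real ?k)) ^ (2 * N)))"
    by (simp only: sum_distrib_left mult_ac)
  also have "\<dots> = (\<Sum>j<?k. \<Sum>i\<le>K. 2 / real ?k * ((x ^ i * y ^ (K - i) * ?s j i) * (2 * cos (pi * real j / real ?k)) ^ (2 * N)))"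
    by (rule sum.swap)
  also have "\<dots> = 2 / real ?k * (\<Sum>j<?k. (x ^ K * mode_weight (y / x) ?k j) * (2 * cos (pi * real j / real ?k)) ^ (2 * N))"
    unfolding w by (simp only: sum_distrib_left sum_distrib_right)
  also have "\<dots> = 2 / real ?k * (\<Sum>j<?k. (x ^ K * mode_weight (y / x) ?k j) *
                (4 ^ N * cos (pi * real j / real ?k) ^ (2 * N)))"
    by (simp add: power_mult_distrib power_mult)
  finally show ?thesis by (simp only: sum_distrib_left mult_ac)
qed

text \<open>
  For a single bridge, the product of the two geometric tails that start at its extrema is
  arranged as a Cauchy product, that is, by the width of the strip; then the bridges in each strip
  are counted.
\<close>

lemma bridge_sums:
  fixes x y :: real
  assumes x: "0 < x" "x < 1" and y: "0 < y" "y < 1"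
  shows "(\<lambda>K. (1 - x) * (1 - y) * 4 ^ N * x ^ K * (2 / real (K + 2) *
       (\<Sum>j<K + 2. mode_weight (y / x) (K + 2) j * cos (pi * real j / real (K + 2)) ^ (2 * N))))
     sums (\<Sum>s | length s = 2 * N \<and> pos s = 0. x ^ peak s * y ^ peak (map Not s))"
proof -
  let ?B = "{s. length s = 2 * N \<and> pos s = 0}"
  have fin: "finite ?B" by (rule finite_subset[OF _ finite_bool_lists[of "2 * N"]]) auto
  define X where "X s i = x ^ i * of_bool (peak s \<le> i)" for s i
  define Y where "Y s i = y ^ i * of_bool (peak (map Not s) \<le> i)" for s i
  have X: "X s sums (x ^ peak s / (1 - x))" and Y: "Y s sums (y ^ peak (map Not s) / (1 - y))" for s
    unfolding X_def Y_def using x y by (auto intro!: geometric_tail_sums)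
  have norm: "norm (X s i) = X s i" "norm (Y s i) = Y s i" for s i
    using x y by (auto simp: X_def Y_def)
  have "(\<lambda>K. \<Sum>i\<le>K. X s i * Y s (K - i)) sums (x ^ peak s / (1 - x) * (y ^ peak (map Not s) / (1 - y)))" for s
  proof -
    have "summable (\<lambda>i. norm (X s i))" "summable (\<lambda>i. norm (Y s i))"
      unfolding norm using X Y by (auto simp: sums_iff)
    from Cauchy_product_sums[OF this] show ?thesis
      using X[of s] Y[of s] by (simp add: sums_iff)
  qed
  then have "(\<lambda>K. \<Sum>s\<in>?B. \<Sum>i\<le>K. X s i * Y s (K - i)) sums
      (\<Sum>s\<in>?B. x ^ peak s / (1 - x) * (y ^ peak (map Not s) / (1 - y)))"
    by (intro sums_sum)
  from sums_mult[OF this, of "(1 - x) * (1 - y)"]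
  have "(\<lambda>K. (1 - x) * (1 - y) * (\<Sum>s\<in>?B. \<Sum>i\<le>K. X s i * Y s (K - i))) sums
      ((1 - x) * (1 - y) * (\<Sum>s\<in>?B. x ^ peak s / (1 - x) * (y ^ peak (map Not s) / (1 - y))))" .
  moreover have "(1 - x) * (1 - y) * (\<Sum>s\<in>?B. x ^ peak s / (1 - x) * (y ^ peak (map Not s) / (1 - y))) =
      (\<Sum>s\<in>?B. x ^ peak s * y ^ peak (map Not s))"
  proof -
    have "(1 - x) * (1 - y) * (u / (1 - x) * (v / (1 - y))) = u * v" for u v
      using x y by (simp add: divide_simps)
    then show ?thesis unfolding sum_distrib_left by simp
  qed
  moreover have "(\<Sum>s\<in>?B. \<Sum>i\<le>K. X s i * Y s (K - i)) =
      (\<Sum>i\<le>K. x ^ i * y ^ (K - i) * real (card (strip_paths (2 * N) i (K - i) 0)))" for K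
  proof -
    have "(\<Sum>s\<in>?B. \<Sum>i\<le>K. X s i * Y s (K - i)) = (\<Sum>i\<le>K. \<Sum>s\<in>?B. X s i * Y s (K - i))"
      by (rule sum.swap)
    also have "\<dots> = (\<Sum>i\<le>K. x ^ i * y ^ (K - i) * real (card (strip_paths (2 * N) i (K - i) 0)))"
    proof (intro sum.cong refl)
      fix i
      have "(\<Sum>s\<in>?B. X s i * Y s (K - i)) =
          (\<Sum>s\<in>?B. x ^ i * y ^ (K - i) * of_bool (s \<in> strip_paths (2 * N) i (K - i) 0))"
        by (intro sum.cong) (auto simp: X_def Y_def strip_paths_def)
      also have "\<dots> = x ^ i * y ^ (K - i) * (\<Sum>s\<in>?B. of_bool (s \<in> strip_paths (2 * N) i (K - i) 0))"
        by (simp only: sum_distrib_left)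
      also have "(\<Sum>s\<in>?B. of_bool (s \<in> strip_paths (2 * N) i (K - i) 0)) = 
          real (card (?B \<inter> {s. s \<in> strip_paths (2 * N) i (K - i) 0}))"
        using fin by (intro sum_of_bool_eq)
      also have "?B \<inter> {s. s \<in> strip_paths (2 * N) i (K - i) 0} = strip_paths (2 * N) i (K - i) 0"
        by (auto simp: strip_paths_def)
      finally show "(\<Sum>s\<in>?B. X s i * Y s (K - i)) =
          x ^ i * y ^ (K - i) * real (card (strip_paths (2 * N) i (K - i) 0))" .
    qed
    finally show ?thesis .
  qed
  ultimately show ?thesis by (simp only: strip_sum[OF x(1)] mult.assoc[symmetric])
qed

section \<open>Laplace asymptotics of the leading modes\<close>

text \<open>
  A crude form of \<open>x ^ n \<le> fact n * exp x\<close> that follows from \<open>u \<le> exp u\<close> at \<open>u = x / n\<close>.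
\<close>

lemma power_le_exp:
  fixes x :: real
  assumes "x \<ge> 0"
  shows "x ^ n \<le> real n ^ n * exp x"
proof (cases "n = 0")
  case False
  have "x / real n \<le> exp (x / real n)" using exp_ge_add_one_self[of "x / real n"] by linarith
  then have "(x / real n) ^ n \<le> exp (x / real n) ^ n" using assms by (intro power_mono) auto
  also have "\<dots> = exp x" using False by (simp flip: exp_of_nat_mult)
  finally show ?thesis using False by (simp add: power_divide field_simps)
qed (use assms in auto)

text \<open>
  The product of the cosine and \<open>exp (x^2 / 2)\<close> decreases, since \<open>x cos x \<le> sin x\<close>.
\<close>

lemma cos_le_gaussian:
  fixes x :: real
  assumes "0 \<le> x" "x \<le> pi / 2"
  shows "cos x \<le> exp (- x\<^sup>2 / 2)"
proof -
  define f where "f x = cos x * exp (x\<^sup>2 / 2)" for x :: real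
  have d: "(f has_real_derivative (x * cos x - sin x) * exp (x\<^sup>2 / 2)) (at x)" for x
    unfolding f_def by (auto intro!: derivative_eq_intros simp: algebra_simps)
  have neg: "y * cos y \<le> sin y" if "0 \<le> y" "y \<le> x" for y
  proof -
    define g where "g y = y * cos y - sin y" for y :: real
    have "g y \<le> g 0"
    proof (rule DERIV_nonpos_imp_nonincreasing[OF that(1)])
      fix z assume z: "0 \<le> z" "z \<le> y"
      have "(g has_real_derivative - (z * sin z)) (at z)"
        unfolding g_def by (auto intro!: derivative_eq_intros)
      moreover have "- (z * sin z) \<le> 0" using z that assms by (auto intro!: mult_nonneg_nonneg sin_ge_zero)
      ultimately show "\<exists>D. (g has_real_derivative D) (at z) \<and> D \<le> 0" by blast
    qed
    then show ?thesis by (simp add: g_def)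
  qed
  have "f x \<le> f 0"
  proof (rule DERIV_nonpos_imp_nonincreasing[OF assms(1)])
    fix y assume "0 \<le> y" "y \<le> x"
    then have "(y * cos y - sin y) * exp (y\<^sup>2 / 2) \<le> 0"
      using neg by (simp add: mult_le_0_iff)
    then show "\<exists>D. (f has_real_derivative D) (at y) \<and> D \<le> 0" using d by blast
  qed
  then show ?thesis by (simp add: f_def exp_minus field_simps)
qed

lemma cos_ge_gaussian:
  fixes x :: real
  assumes "\<bar>x\<bar> \<le> 1"
  shows "exp (- x\<^sup>2 / 2 - x ^ 4 / 2) \<le> cos x"
proof -
  define z where "z = x\<^sup>2 / 2"
  have z: "0 \<le> z" "z \<le> 1 / 2" using assms by (auto simp: z_def abs_square_le_1)
  have "exp (- z - 2 * z\<^sup>2) \<le> exp (ln (1 - z))"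
    using ln_one_minus_pos_lower_bound[OF z] by simp
  also have "\<dots> = 1 - z" using z by simp
  also have "1 - z \<le> cos x"
  proof -
    have "cos x = 1 - 2 * (sin (x / 2))\<^sup>2" using cos_double_sin[of "x / 2"] by simp
    moreover have "(sin (x / 2))\<^sup>2 \<le> (x / 2)\<^sup>2"
      using abs_sin_x_le_abs_x[of "x / 2"] by (simp only: abs_le_square_iff)
    ultimately show ?thesis by (simp add: z_def power_divide)
  qed
  also have "- z - 2 * z\<^sup>2 = - x\<^sup>2 / 2 - x ^ 4 / 2"
    by (simp add: z_def power_divide flip: power_mult)
  finally show ?thesis .
qed

lemma borel_measurable_nat_floor:
  fixes a :: "nat \<Rightarrow> real"
  shows "(\<lambda>x :: real. a (nat \<lfloor>x\<rfloor>)) \<in> borel_measurable lborel"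
proof -
  have "(\<lambda>i. a (nat i)) \<in> count_space UNIV \<rightarrow>\<^sub>M borel" by simp
  from measurable_compose[OF measurable_real_floor this] show ?thesis by simp
qed

text \<open>
  Writing a series as an integral of a step function makes dominated convergence on the real
  line available after rescaling.
\<close>

lemma has_bochner_integral_floor:
  fixes a :: "nat \<Rightarrow> real"
  assumes nonneg: "\<And>k. a k \<ge> 0" and a0: "a 0 = 0" and sm: "summable a"
  shows "has_bochner_integral lborel (\<lambda>x :: real. a (nat \<lfloor>x\<rfloor>)) (suminf a)"
proof (rule has_bochner_integral_nn_integral)
  show "(\<lambda>x :: real. a (nat \<lfloor>x\<rfloor>)) \<in> borel_measurable lborel"
    by (rule borel_measurable_nat_floor)
  show "0 \<le> suminf a" using nonneg sm by (intro suminf_nonneg)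
  define I where "I k = {real k..<real k + 1}" for k
  have disj: "disjoint_family I"
    unfolding disjoint_family_on_def I_def by (auto simp: not_less)
  have "ennreal (a (nat \<lfloor>x\<rfloor>)) = (\<Sum>k. ennreal (a k) * indicator (I k) x)" for x :: real
  proof (cases "x \<ge> 0")
    case True
    then have "x \<in> I (nat \<lfloor>x\<rfloor>)" unfolding I_def by (auto simp: of_nat_nat)
    then show ?thesis using suminf_cmult_indicator[OF disj, of x _ "\<lambda>k. ennreal (a k)"] by simp
  next
    case False
    then have "indicator (I k) x = (0 :: ennreal)" for k by (auto simp: I_def indicator_def)
    then show ?thesis using False a0 by simp
  qed
  then have "(\<integral>\<^sup>+x. ennreal (a (nat \<lfloor>x :: real\<rfloor>)) \<partial>lborel) = (\<integral>\<^sup>+x. (\<Sum>k. ennreal (a k) * indicator (I k) x) \<partial>lborel)"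
    by simp
  also have "\<dots> = (\<Sum>k. \<integral>\<^sup>+x. ennreal (a k) * indicator (I k) x \<partial>lborel)"
    by (rule nn_integral_suminf) (auto simp: I_def)
  also have "\<dots> = (\<Sum>k. ennreal (a k))"
    by (simp add: nn_integral_cmult_indicator I_def)
  also have "\<dots> = ennreal (suminf a)" using nonneg sm by (intro suminf_ennreal2)
  finally show "(\<integral>\<^sup>+x. ennreal (a (nat \<lfloor>x :: real\<rfloor>)) \<partial>lborel) = ennreal (suminf a)" .
qed (use nonneg in auto)

lemma gaussian_integral:
  assumes "C > 0"
  shows "(\<integral>y. exp (- C * y\<^sup>2 / 2) \<partial>lborel) = sqrt (2 * pi / C)"
proof -
  have nd: "normal_density 0 (1 / sqrt C) = (\<lambda>y. 1 / sqrt (2 * pi / C) * exp (- C * y\<^sup>2 / 2))"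
    using assms by (auto simp: normal_density_def power_divide field_simps fun_eq_iff)
  have "integral\<^sup>L lborel (normal_density 0 (1 / sqrt C)) = 1"
    using assms by (intro integral_normal_density) simp
  then have "(\<integral>y. 1 / sqrt (2 * pi / C) * exp (- C * y\<^sup>2 / 2) \<partial>lborel) = 1"
    by (simp only: nd)
  then have "1 / sqrt (2 * pi / C) * (\<integral>y. exp (- C * y\<^sup>2 / 2) \<partial>lborel) = 1"
    by (simp only: integral_mult_right_zero)
  moreover have "sqrt (2 * pi / C) > 0" using assms by simp
  ultimately show ?thesis by (simp only: times_divide_eq_left mult_1 divide_eq_1_iff)
qed

lemma integrable_cauchy: "integrable lborel (\<lambda>y :: real. inverse (1 + y\<^sup>2))"
proof -
  have "einterval (- \<infinity>) \<infinity> = UNIV" by (auto simp: einterval_def)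
  then show ?thesis using integrable_inverse_1_plus_square by (simp add: set_integrable_def)
qed

text \<open>
  For \<open>L = ln q\<close> the phase \<open>L k + pi^2 t^3 / k^2\<close>, as a function of \<open>k\<close>, is minimal at
  \<open>k = \<xi> t\<close>; this is the equation for \<open>\<xi>\<close>. In the applications \<open>t\<close> is the cube root of \<open>N\<close>.
\<close>

locale laplace_scale =
  fixes L \<xi> :: real
  assumes L_pos: "L > 0" and \<xi>_pos: "\<xi> > 0" and \<xi>_cubed: "\<xi> ^ 3 * L = 2 * pi\<^sup>2"
begin

definition rate :: real where
  "rate = 3 / 2 * \<xi> * L"

text \<open>
  The amount by which the phase exceeds its minimal value \<open>rate * t\<close>. The factorisation shows the
  double zero at the minimum.
\<close>

definition excess :: "real \<Rightarrow> real \<Rightarrow> real" where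
  "excess k t = L * (k - \<xi> * t)\<^sup>2 * (2 * k + \<xi> * t) / (2 * k\<^sup>2)"

lemma phase_eq:
  assumes "k > 0"
  shows "L * k + pi\<^sup>2 * t ^ 3 / k\<^sup>2 = rate * t + excess k t"
proof -
  have p: "pi\<^sup>2 = \<xi> ^ 3 * L / 2" using \<xi>_cubed by simp
  show ?thesis using assms unfolding p rate_def excess_def
    by (simp add: field_simps power2_eq_square power3_eq_cube)
qed

lemma excess_nonneg: "k > 0 \<Longrightarrow> t \<ge> 0 \<Longrightarrow> excess k t \<ge> 0"
  using L_pos \<xi>_pos by (simp add: excess_def)

text \<open>
  Near the minimum the excess is quadratic in the rescaled variable, far to the right of it
  linear. Both are bounded below by one linear function, which suffices for domination.
\<close>

lemma excess_ge:
  assumes k: "k > 0" and t: "t \<ge> 1"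
  shows "excess k t \<ge> min (L / (2 * \<xi>)) (L / 2) * (\<bar>(k - \<xi> * t) / sqrt t\<bar> - 1)"
proof -
  let ?k0 = "\<xi> * t" and ?c = "min (L / (2 * \<xi>)) (L / 2)"
  define y where "y = (k - ?k0) / sqrt t"
  have k0: "?k0 > 0" using t \<xi>_pos by simp
  have c: "?c \<ge> 0" using L_pos \<xi>_pos by simp
  have ge: "excess k t \<ge> L * (k - ?k0)\<^sup>2 / k"
  proof -
    have "L * (k - ?k0)\<^sup>2 / k = L * (k - ?k0)\<^sup>2 * (2 * k) / (2 * k\<^sup>2)"
      using k by (simp add: power2_eq_square)
    also have "\<dots> \<le> excess k t"
      unfolding excess_def using k k0 L_pos by (intro divide_right_mono mult_left_mono) auto
    finally show ?thesis .
  qed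
  show ?thesis
  proof (cases "k \<le> 2 * ?k0")
    case True
    have y2: "(k - ?k0)\<^sup>2 = y\<^sup>2 * t" using t by (simp add: y_def power_divide)
    have "?c * (\<bar>y\<bar> - 1) \<le> ?c * y\<^sup>2"
    proof (rule mult_left_mono[OF _ c])
      have "0 \<le> (\<bar>y\<bar> - 1)\<^sup>2" by simp
      then have "2 * \<bar>y\<bar> - 1 \<le> y\<^sup>2" by (simp add: power2_diff)
      then show "\<bar>y\<bar> - 1 \<le> y\<^sup>2" by linarith
    qed
    also have "\<dots> \<le> L / (2 * \<xi>) * y\<^sup>2" by (intro mult_right_mono) auto
    also have "\<dots> = L * (k - ?k0)\<^sup>2 / (2 * ?k0)" using t unfolding y2 by (simp add: field_simps)
    also have "\<dots> \<le> L * (k - ?k0)\<^sup>2 / k"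
      using True k L_pos k0 by (intro divide_left_mono) auto
    finally show ?thesis using ge by (simp add: y_def)
  next
    case False
    have sq: "sqrt t \<ge> 1" "sqrt t > 0" using t by auto
    have pos: "k - ?k0 > 0" using False k0 by linarith
    then have y: "\<bar>y\<bar> = y" "y \<ge> 0" using sq by (auto simp: y_def)
    have "?c * (\<bar>y\<bar> - 1) \<le> L / 2 * y"
      using y c L_pos by (intro order_trans[OF mult_left_mono[of "\<bar>y\<bar> - 1" y ?c] mult_right_mono]) auto
    also have "y \<le> k - ?k0" using sq pos by (simp add: y_def divide_le_eq)
    then have "L / 2 * y \<le> L / 2 * (k - ?k0)" using L_pos by simp
    also have "\<dots> \<le> L * (k - ?k0)\<^sup>2 / k"
    proof -
      have "k * (k - ?k0) \<le> 2 * (k - ?k0) * (k - ?k0)"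
        using False pos by (intro mult_right_mono) auto
      then have "L * (k * (k - ?k0)) \<le> L * (2 * (k - ?k0) * (k - ?k0))" using L_pos by simp
      then show ?thesis using k by (simp add: field_simps power2_eq_square)
    qed
    finally show ?thesis using ge by (simp add: y_def)
  qed
qed

text \<open>
  The polynomial factor is large only for small \<open>k\<close>, where the excess grows like a multiple of
  \<open>t / k\<close>.
\<close>

lemma power_excess_bounded:
  "\<exists>D\<ge>0. \<forall>k t. k > 0 \<longrightarrow> t \<ge> 1 \<longrightarrow> (t / k) ^ \<alpha> * exp (- excess k t / 2) \<le> D"
proof -
  define c where "c = L * \<xi>\<^sup>2 / 16"
  have c: "c > 0" using L_pos \<xi>_pos by (simp add: c_def)
  define D where "D = (2 / \<xi>) ^ \<alpha> + (real \<alpha> / c) ^ \<alpha>"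
  have D: "(2 / \<xi>) ^ \<alpha> \<le> D" "(real \<alpha> / c) ^ \<alpha> \<le> D" "D \<ge> 0"
    using c \<xi>_pos by (auto simp: D_def)
  have "(t / k) ^ \<alpha> * exp (- excess k t / 2) \<le> D" if k: "k > 0" and t: "t \<ge> 1" for k t
  proof (cases "k \<ge> \<xi> * t / 2")
    case True
    have "(t / k) ^ \<alpha> * exp (- excess k t / 2) \<le> (2 / \<xi>) ^ \<alpha> * 1"
      using True k t \<xi>_pos excess_nonneg[of k t]
      by (intro mult_mono power_mono) (auto simp: field_simps)
    then show ?thesis using D by simp
  next
    case False
    let ?k0 = "\<xi> * t"
    have k0: "?k0 > 0" "?k0 \<ge> \<xi>" using t \<xi>_pos by auto
    have "c * (t / k) \<le> excess k t / 2"
    proof -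
      have "c * (t / k) = L * (\<xi> * ?k0) / (16 * k)" by (simp add: c_def power2_eq_square)
      also have "\<dots> \<le> L * (?k0 * ?k0) / (16 * k)"
        using k k0 L_pos by (intro divide_right_mono mult_left_mono mult_right_mono) auto
      also have "\<dots> = L * (?k0\<^sup>2 * (k / 16)) / k\<^sup>2" using k by (simp add: power2_eq_square)
      also have "\<dots> \<le> L * (?k0\<^sup>2 * (?k0 / 16)) / k\<^sup>2"
        using False k k0 L_pos by (intro divide_right_mono mult_left_mono) auto
      also have "\<dots> = L * ((?k0 / 2)\<^sup>2 * ?k0) / (4 * k\<^sup>2)" by (simp add: power_divide)
      also have "\<dots> \<le> L * ((?k0 - k)\<^sup>2 * (2 * k + ?k0)) / (4 * k\<^sup>2)"
        using False k k0 L_pos by (intro divide_right_mono mult_left_mono mult_mono power_mono) auto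
      also have "\<dots> = excess k t / 2" by (simp add: excess_def power2_commute)
      finally show ?thesis .
    qed
    then have "(t / k) ^ \<alpha> * exp (- excess k t / 2) \<le> (t / k) ^ \<alpha> * exp (- (c * (t / k)))"
      using t k by (intro mult_left_mono) auto
    also have "\<dots> = (c * (t / k)) ^ \<alpha> * exp (- (c * (t / k))) / c ^ \<alpha>"
      using c by (simp add: power_mult_distrib power_divide)
    also have "\<dots> \<le> (real \<alpha> ^ \<alpha> * exp (c * (t / k))) * exp (- (c * (t / k))) / c ^ \<alpha>"
      using c t k by (intro divide_right_mono mult_right_mono power_le_exp) auto
    also have "\<dots> = (real \<alpha> / c) ^ \<alpha>" by (simp add: power_divide exp_minus)
    finally show ?thesis using D by simp
  qed
  with D show ?thesis by blast
qed

lemma exp_excess_bounded: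
  "\<exists>D\<ge>0. \<forall>k t y. k > 0 \<longrightarrow> t \<ge> 1 \<longrightarrow> \<bar>(k - \<xi> * t) / sqrt t - y\<bar> \<le> 1 \<longrightarrow>
     exp (- excess k t / 2) \<le> D * inverse (1 + y\<^sup>2)"
proof -
  define c where "c = min (L / (2 * \<xi>)) (L / 2) / 2"
  have c: "c > 0" using L_pos \<xi>_pos by (simp add: c_def)
  define m where "m = min 1 (c\<^sup>2 / 2)"
  have m: "m > 0" "m \<le> 1" "m \<le> c\<^sup>2 / 2" using c by (auto simp: m_def)
  have "exp (- excess k t / 2) \<le> (exp (2 * c) / m) * inverse (1 + y\<^sup>2)"
    if k: "k > 0" and t: "t \<ge> 1" and y: "\<bar>(k - \<xi> * t) / sqrt t - y\<bar> \<le> 1" for k t y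
  proof -
    have "c * (\<bar>y\<bar> - 2) \<le> c * (\<bar>(k - \<xi> * t) / sqrt t\<bar> - 1)"
      using y c by (intro mult_left_mono) linarith+
    also have "\<dots> \<le> excess k t / 2"
      using excess_ge[OF k t] by (simp add: c_def)
    finally have "exp (- excess k t / 2) \<le> exp (2 * c) * exp (- (c * \<bar>y\<bar>))"
      by (simp add: algebra_simps flip: exp_add)
    moreover have "m * (1 + y\<^sup>2) \<le> exp (c * \<bar>y\<bar>)"
    proof -
      have "m * (1 + y\<^sup>2) \<le> 1 + c\<^sup>2 / 2 * y\<^sup>2"
        using m mult_right_mono[OF m(3), of "y\<^sup>2"] by (simp add: distrib_left)
      also have "\<dots> \<le> exp (c * \<bar>y\<bar>)"
      proof -
        have nn: "0 \<le> c * \<bar>y\<bar>" using c by simp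
        from exp_lower_Taylor_quadratic[OF nn] nn show ?thesis
          unfolding power_mult_distrib power2_abs by linarith
      qed
      finally show ?thesis .
    qed
    then have "exp (- (c * \<bar>y\<bar>)) \<le> inverse (m * (1 + y\<^sup>2))"
      unfolding exp_minus using m by (intro le_imp_inverse_le mult_pos_pos) (auto intro: add_pos_nonneg)
    then have "exp (2 * c) * exp (- (c * \<bar>y\<bar>)) \<le> exp (2 * c) * inverse (m * (1 + y\<^sup>2))" by simp
    ultimately have "exp (- excess k t / 2) \<le> exp (2 * c) * inverse (m * (1 + y\<^sup>2))"
      by (rule order_trans)
    then show ?thesis by (simp only: inverse_mult_distrib divide_inverse mult.assoc)
  qed
  moreover have "exp (2 * c) / m \<ge> 0" using m by simp
  ultimately show ?thesis by blast
qed


lemma excess_eq: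
  assumes "k > 0" "t > 0"
  shows "excess k t = L * ((k - \<xi> * t) / sqrt t)\<^sup>2 * (2 * (k / t) + \<xi>) / (2 * (k / t)\<^sup>2)"
  using assms unfolding excess_def by (simp add: field_simps power2_eq_square)

text \<open>
  After the substitution \<open>k = \<xi> t + sqrt t * y\<close>, with \<open>t\<close> the cube root of \<open>N\<close>, the normalised series
  is the integral over \<open>y\<close> of functions that converge to a Gaussian and are dominated by a multiple
  of \<open>1 / (1 + y^2)\<close>. One half of the excess pays for the polynomial weight, the other half for
  the decay in \<open>y\<close>. The weights vanish at 0 and 1 because these are not widths of strips.
\<close>

lemma laplace_sum:
  fixes v :: "nat \<Rightarrow> real" and \<alpha> :: nat
  assumes v0: "v 0 = 0" "v 1 = 0" and v_nonneg: "\<And>k. v k \<ge> 0"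
    and v_lim: "(\<lambda>k. real k ^ \<alpha> * v k) \<longlonglongrightarrow> V"
  shows "(\<lambda>N. (\<Sum>k. v k * exp (- L * real k) * cos (pi / real k) ^ (2 * N)) *
            exp (rate * root 3 (real N)) * root 3 (real N) ^ \<alpha> / sqrt (root 3 (real N)))
     \<longlonglongrightarrow> V / \<xi> ^ \<alpha> * sqrt (2 * pi / (3 * L / \<xi>))"
proof -
  \<comment> \<open>The index is shifted by one so that \<open>t N \<ge> 1\<close>, as the bounds on the excess require.\<close>
  define t where "t N = root 3 (real (Suc N))" for N
  define a where "a N k = v k * exp (- L * real k) * cos (pi / real k) ^ (2 * Suc N)" for N k
  define kk where "kk N y = nat \<lfloor>\<xi> * t N + sqrt (t N) * y\<rfloor>" for N y
  define h where "h N y = a N (kk N y) * (exp (rate * t N) * t N ^ \<alpha>)" for N y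
  \<comment> \<open>The error made by replacing the cosine by a Gaussian; it lies between 0 and 1 and tends to 1.\<close>
  define e where "e N k = (cos (pi / k) * exp ((pi / k)\<^sup>2 / 2)) ^ (2 * Suc N)" for N and k :: real
  have t3: "t N ^ 3 = real (Suc N)" for N by (simp add: t_def del: of_nat_Suc)
  have t1: "t N \<ge> 1" for N by (simp add: t_def del: of_nat_Suc)
  have t0: "t N > 0" "sqrt (t N) > 0" "sqrt (t N) \<ge> 1" for N using t1[of N] by auto
  have t_lim: "filterlim t at_top sequentially"
    unfolding t_def by real_asymp
  have e_bounds: "0 \<le> e N k" "e N k \<le> 1" if "k \<ge> 2" for N k
  proof -
    have x: "0 \<le> pi / k" "pi / k \<le> pi / 2"
      using that by (simp, intro divide_left_mono) auto
    have c: "cos (pi / k) \<ge> 0" using x by (intro cos_ge_zero) auto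
    have nn: "0 \<le> cos (pi / k) * exp ((pi / k)\<^sup>2 / 2)" using c by simp
    have le1: "cos (pi / k) * exp ((pi / k)\<^sup>2 / 2) \<le> 1"
      using cos_le_gaussian[OF x] by (simp add: exp_minus field_simps)
    show "0 \<le> e N k" "e N k \<le> 1"
      unfolding e_def by (rule zero_le_power[OF nn], rule power_le_one[OF nn le1])
  qed
  have factor: "a N k * (exp (rate * t N) * t N ^ \<alpha>) =
      real k ^ \<alpha> * v k * (t N / real k) ^ \<alpha> * exp (- excess (real k) (t N)) * e N (real k)"
    if "k > 0" for N k
  proof -
    have k: "real k > 0" using that by simp
    have "L * real k + pi\<^sup>2 * real (Suc N) / (real k)\<^sup>2 = rate * t N + excess (real k) (t N)"
      using phase_eq[OF k, of "t N"] by (simp only: t3)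
    then have "exp (- L * real k) * exp (rate * t N) =
          exp (- excess (real k) (t N)) * exp (pi\<^sup>2 * real (Suc N) / (real k)\<^sup>2)"
      by (simp flip: exp_add)
    moreover have "e N (real k) = cos (pi / real k) ^ (2 * Suc N) * exp (pi\<^sup>2 * real (Suc N) / (real k)\<^sup>2)"
    proof -
      have "real (2 * n) * ((pi / real k)\<^sup>2 / 2) = pi\<^sup>2 * real n / (real k)\<^sup>2" for n
        by (simp add: power_divide)
      then show ?thesis unfolding e_def power_mult_distrib exp_of_nat_mult[symmetric] by (simp only:)
    qed
    moreover have "real k ^ \<alpha> * (t N / real k) ^ \<alpha> = t N ^ \<alpha>"
      using k by (simp add: power_divide)
    moreover have "w * A * c * (B * T) = P * w * Q * X * E'"
      if "A * B = X * Y" "E' = c * Y" "P * Q = T" for w A B c T P Q X Y E' :: real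
    proof -
      have "w * A * c * (B * T) = w * c * T * (A * B)" by simp
      also have "\<dots> = w * c * (P * Q) * (X * Y)" by (simp only: that)
      finally show ?thesis by (simp add: that(2))
    qed
    ultimately show ?thesis unfolding a_def by blast
  qed
  obtain D0 where D0: "\<And>k. real k ^ \<alpha> * v k \<le> D0" "D0 \<ge> 0"
  proof -
    obtain K where K: "\<And>k. norm (real k ^ \<alpha> * v k) \<le> K"
      using convergent_imp_Bseq[OF convergentI[OF v_lim]] unfolding Bseq_def by blast
    show ?thesis
    proof (rule that)
      show "real k ^ \<alpha> * v k \<le> K" for k using K[of k] by simp
      show "K \<ge> 0" using norm_ge_zero K[of 0] by (rule order_trans)
    qed
  qed
  obtain D1 where D1: "D1 \<ge> 0"
    "\<And>k t. k > 0 \<Longrightarrow> t \<ge> 1 \<Longrightarrow> (t / k) ^ \<alpha> * exp (- excess k t / 2) \<le> D1"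
    using power_excess_bounded[of \<alpha>] by blast
  obtain D2 where D2: "D2 \<ge> 0"
    "\<And>k t y. k > 0 \<Longrightarrow> t \<ge> 1 \<Longrightarrow> \<bar>(k - \<xi> * t) / sqrt t - y\<bar> \<le> 1 \<Longrightarrow>
       exp (- excess k t / 2) \<le> D2 * inverse (1 + y\<^sup>2)"
    using exp_excess_bounded by blast
  have a_nonneg: "a N k \<ge> 0" for N k
    unfolding a_def by (intro mult_nonneg_nonneg v_nonneg exp_ge_zero zero_le_even_power')
  have a0: "a N 0 = 0" "a N 1 = 0" for N using v0 by (simp_all add: a_def)
  have a_summable: "summable (a N)" for N
  proof (rule summable_comparison_test)
    have "norm (a N k) \<le> D0 * exp (- L) ^ k" for k
    proof (cases "k = 0")
      case False
      have "v k \<le> real k ^ \<alpha> * v k"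
        using mult_right_mono[OF one_le_power[of "real k" \<alpha>] v_nonneg[of k]] False by simp
      also have "\<dots> \<le> D0" by (rule D0)
      finally have "v k \<le> D0" .
      moreover have "cos (pi / real k) ^ (2 * Suc N) \<le> 1"
        unfolding power_mult by (rule power_le_one) (simp_all add: abs_square_le_1)
      ultimately have "v k * exp (- L * real k) * cos (pi / real k) ^ (2 * Suc N) \<le> D0 * exp (- L * real k) * 1"
        using D0(2) v_nonneg
        by (intro mult_mono mult_nonneg_nonneg zero_le_even_power' order_refl exp_ge_zero)
      then show ?thesis using a_nonneg[of N k] unfolding a_def
        by (simp add: exp_of_nat_mult[symmetric] mult.commute)
    qed (use a0 D0 in simp)
    then show "\<exists>N'. \<forall>n\<ge>N'. norm (a N n) \<le> D0 * exp (- L) ^ n" by blast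
    show "summable (\<lambda>k. D0 * exp (- L) ^ k)"
      using L_pos by (intro summable_mult summable_geometric) auto
  qed
  have kk_close: "\<bar>(real (kk N y) - \<xi> * t N) / sqrt (t N) - y\<bar> \<le> 1 / sqrt (t N)"
    if "kk N y > 0" for N y
  proof -
    let ?z = "\<xi> * t N + sqrt (t N) * y"
    have "real (kk N y) = of_int \<lfloor>?z\<rfloor>" using that by (simp add: kk_def of_nat_nat)
    then have "\<bar>real (kk N y) - ?z\<bar> \<le> 1" by linarith
    moreover have "(real (kk N y) - \<xi> * t N) / sqrt (t N) - y = (real (kk N y) - ?z) / sqrt (t N)"
      using t0[of N] by (simp add: field_simps)
    ultimately show ?thesis using t0[of N] by (simp add: abs_divide divide_right_mono)
  qed
  have h_bound: "norm (h N y) \<le> D0 * D1 * D2 * inverse (1 + y\<^sup>2)" for N y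
  proof (cases "kk N y \<ge> 2")
    case False
    then have "kk N y = 0 \<or> kk N y = 1" by auto
    then have "h N y = 0" using a0 by (auto simp: h_def)
    then show ?thesis using D0 D1 D2 by simp
  next
    case True
    define k where "k = real (kk N y)"
    have k: "k \<ge> 2" "k > 0" "kk N y > 0" using True by (auto simp: k_def)
    have close: "\<bar>(k - \<xi> * t N) / sqrt (t N) - y\<bar> \<le> 1"
    proof -
      have "1 / sqrt (t N) \<le> 1" using t0[of N] by simp
      with kk_close[OF k(3)] show ?thesis unfolding k_def[symmetric] by (rule order_trans)
    qed
    have half: "exp (- excess k (t N)) = exp (- excess k (t N) / 2) * exp (- excess k (t N) / 2)"
      by (simp flip: exp_add)
    have "h N y = (k ^ \<alpha> * v (kk N y)) * ((t N / k) ^ \<alpha> * exp (- excess k (t N) / 2)) *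
        exp (- excess k (t N) / 2) * e N k"
      unfolding h_def factor[OF k(3)] k_def[symmetric] half by (simp only: mult.assoc)
    also have "\<dots> \<le> D0 * D1 * (D2 * inverse (1 + y\<^sup>2)) * 1"
      using D0 D1(1) D2(1) D1(2)[OF k(2) t1] D2(2)[OF k(2) t1 close] e_bounds[OF k(1)] k v_nonneg t0[of N]
      unfolding k_def by (intro mult_mono mult_nonneg_nonneg zero_le_power) auto
    finally show ?thesis
      using a_nonneg[of N "kk N y"] t0[of N] by (simp add: h_def mult.assoc)
  qed
  have h_lim: "(\<lambda>N. h N y) \<longlonglongrightarrow> V / \<xi> ^ \<alpha> * exp (- (3 * L / \<xi>) * y\<^sup>2 / 2)" for y
  proof -
    let ?z = "\<lambda>N. \<xi> * t N + sqrt (t N) * y"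
    have z_lim: "filterlim ?z at_top sequentially"
      using \<xi>_pos unfolding t_def by real_asymp
    have ev: "\<forall>\<^sub>F N in sequentially. ?z N \<ge> 2"
      using z_lim by (simp add: filterlim_at_top)
    then have ev2: "\<forall>\<^sub>F N in sequentially. kk N y \<ge> 2"
      by eventually_elim (simp add: kk_def le_nat_iff le_floor_iff)
    have kk_lim: "filterlim (\<lambda>N. kk N y) at_top sequentially"
      unfolding kk_def
      by (intro filterlim_compose[OF filterlim_nat_sequentially] filterlim_compose[OF filterlim_floor_sequentially] z_lim)
    have kr_lim: "filterlim (\<lambda>N. real (kk N y)) at_top sequentially"
      by (rule filterlim_compose[OF filterlim_real_sequentially kk_lim])
    have inv: "(\<lambda>N. 1 / sqrt (t N)) \<longlonglongrightarrow> 0" unfolding t_def by real_asymp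
    have y_lim: "(\<lambda>N. (real (kk N y) - \<xi> * t N) / sqrt (t N)) \<longlonglongrightarrow> y"
    proof (rule LIM_zero_cancel, rule Lim_null_comparison[OF _ inv])
      show "\<forall>\<^sub>F N in sequentially. norm ((real (kk N y) - \<xi> * t N) / sqrt (t N) - y) \<le> 1 / sqrt (t N)"
        using ev2 by eventually_elim (use kk_close in auto)
    qed
    have "(\<lambda>N. \<xi> + (real (kk N y) - \<xi> * t N) / sqrt (t N) * (1 / sqrt (t N))) \<longlonglongrightarrow> \<xi> + y * 0"
      by (intro tendsto_intros y_lim inv)
    moreover have "\<xi> + (real (kk N y) - \<xi> * t N) / sqrt (t N) * (1 / sqrt (t N)) = real (kk N y) / t N" for N
      using t0[of N] by (simp add: field_simps)
    ultimately have u_lim: "(\<lambda>N. real (kk N y) / t N) \<longlonglongrightarrow> \<xi>" by simp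
    have "(\<lambda>N. inverse (real (kk N y) / t N)) \<longlonglongrightarrow> inverse \<xi>"
      using u_lim \<xi>_pos by (intro tendsto_inverse) auto
    then have iu_lim: "(\<lambda>N. t N / real (kk N y)) \<longlonglongrightarrow> 1 / \<xi>" by (simp add: inverse_eq_divide)
    have excess_lim: "(\<lambda>N. excess (real (kk N y)) (t N)) \<longlonglongrightarrow> (3 * L / \<xi>) * y\<^sup>2 / 2"
    proof -
      have lim: "(\<lambda>N. L * ((real (kk N y) - \<xi> * t N) / sqrt (t N))\<^sup>2 * (2 * (real (kk N y) / t N) + \<xi>) /
              (2 * (real (kk N y) / t N)\<^sup>2)) \<longlonglongrightarrow> L * y\<^sup>2 * (2 * \<xi> + \<xi>) / (2 * \<xi>\<^sup>2)"
        using \<xi>_pos by (intro tendsto_intros y_lim u_lim) auto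
      have ev3: "\<forall>\<^sub>F N in sequentially. L * ((real (kk N y) - \<xi> * t N) / sqrt (t N))\<^sup>2 *
          (2 * (real (kk N y) / t N) + \<xi>) / (2 * (real (kk N y) / t N)\<^sup>2) = excess (real (kk N y)) (t N)"
        using ev2 by eventually_elim (subst excess_eq, use t0 in auto)
      have val: "L * y\<^sup>2 * (2 * \<xi> + \<xi>) / (2 * \<xi>\<^sup>2) = (3 * L / \<xi>) * y\<^sup>2 / 2"
        using \<xi>_pos by (simp add: field_simps power2_eq_square)
      from Lim_transform_eventually[OF lim ev3] show ?thesis unfolding val .
    qed
    have e_lim: "(\<lambda>N. e N (real (kk N y))) \<longlonglongrightarrow> 1"
    proof (rule tendsto_sandwich)
      show "\<forall>\<^sub>F N in sequentially. e N (real (kk N y)) \<le> 1"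
        using ev2 by eventually_elim (auto intro: e_bounds)
      show "\<forall>\<^sub>F N in sequentially. exp (- (pi ^ 4 * (t N / real (kk N y)) ^ 3 * (1 / real (kk N y)))) \<le> e N (real (kk N y))"
        using filterlim_at_top[THEN iffD1, OF kr_lim, rule_format, of pi] ev2
      proof eventually_elim
        case (elim N)
        define k where "k = real (kk N y)"
        have k: "k \<ge> pi" "k > 0" using elim by (auto simp: k_def)
        have "exp (- (pi / k)\<^sup>2 / 2 - (pi / k) ^ 4 / 2) \<le> cos (pi / k)"
          using k by (intro cos_ge_gaussian) auto
        then have "exp (- (pi / k)\<^sup>2 / 2 - (pi / k) ^ 4 / 2) * exp ((pi / k)\<^sup>2 / 2) \<le> cos (pi / k) * exp ((pi / k)\<^sup>2 / 2)"
          by (intro mult_right_mono) auto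
        then have "exp (- ((pi / k) ^ 4) / 2) \<le> cos (pi / k) * exp ((pi / k)\<^sup>2 / 2)"
          by (simp flip: exp_add)
        then have "exp (- ((pi / k) ^ 4) / 2) ^ (2 * Suc N) \<le> e N k"
          unfolding e_def by (intro power_mono) auto
        moreover have "exp (- ((pi / k) ^ 4) / 2) ^ (2 * Suc N) = exp (- (pi ^ 4 * (t N / k) ^ 3 * (1 / k)))"
          unfolding exp_of_nat_mult[symmetric] power_divide t3 using k
          by (simp add: field_simps power_numeral_reduce)
        ultimately show ?case unfolding k_def by simp
      qed
      have "(\<lambda>N. 1 / real (kk N y)) \<longlonglongrightarrow> 0"
        by (intro tendsto_divide_0[OF tendsto_const] filterlim_at_top_imp_at_infinity kr_lim)
      then have "(\<lambda>N. exp (- (pi ^ 4 * (t N / real (kk N y)) ^ 3 * (1 / real (kk N y))))) \<longlonglongrightarrow>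
          exp (- (pi ^ 4 * (1 / \<xi>) ^ 3 * 0))"
        by (intro tendsto_intros iu_lim)
      then show "(\<lambda>N. exp (- (pi ^ 4 * (t N / real (kk N y)) ^ 3 * (1 / real (kk N y))))) \<longlonglongrightarrow> 1" by simp
    qed simp
    have lim: "(\<lambda>N. real (kk N y) ^ \<alpha> * v (kk N y) * (t N / real (kk N y)) ^ \<alpha> *
          exp (- excess (real (kk N y)) (t N)) * e N (real (kk N y))) \<longlonglongrightarrow>
        V * (1 / \<xi>) ^ \<alpha> * exp (- ((3 * L / \<xi>) * y\<^sup>2 / 2)) * 1"
      by (intro tendsto_intros filterlim_compose[OF v_lim kk_lim] iu_lim excess_lim e_lim)
    have ev3: "\<forall>\<^sub>F N in sequentially. real (kk N y) ^ \<alpha> * v (kk N y) * (t N / real (kk N y)) ^ \<alpha> *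
          exp (- excess (real (kk N y)) (t N)) * e N (real (kk N y)) = h N y"
      using ev2
    proof eventually_elim
      case (elim N)
      then have "kk N y > 0" by simp
      from factor[OF this, symmetric] show ?case unfolding h_def .
    qed
    have val: "V * (1 / \<xi>) ^ \<alpha> * exp (- ((3 * L / \<xi>) * y\<^sup>2 / 2)) * 1 =
        V / \<xi> ^ \<alpha> * exp (- (3 * L / \<xi>) * y\<^sup>2 / 2)"
    proof -
      have "- ((3 * L / \<xi>) * y\<^sup>2 / 2) = - (3 * L / \<xi>) * y\<^sup>2 / 2" by simp
      then show ?thesis by (simp only: power_divide power_one mult_1_right times_divide_eq_right)
    qed
    from Lim_transform_eventually[OF lim ev3] show ?thesis unfolding val .
  qed
  have h_meas: "h N \<in> borel_measurable lborel" for N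
  proof -
    have "(\<lambda>y. \<xi> * t N + sqrt (t N) * y) \<in> borel \<rightarrow>\<^sub>M borel" by measurable
    from measurable_compose[OF this, of "\<lambda>x. a N (nat \<lfloor>x\<rfloor>)" borel] borel_measurable_nat_floor[of "a N"]
    have "(\<lambda>y. a N (kk N y)) \<in> borel_measurable borel" by (simp add: kk_def)
    then show ?thesis unfolding h_def[abs_def] by simp
  qed
  have "(\<lambda>N. integral\<^sup>L lborel (h N)) \<longlonglongrightarrow>
      (\<integral>y. V / \<xi> ^ \<alpha> * exp (- (3 * L / \<xi>) * y\<^sup>2 / 2) \<partial>lborel)"
  proof (rule integral_dominated_convergence)
    show "integrable lborel (\<lambda>y :: real. D0 * D1 * D2 * inverse (1 + y\<^sup>2))"
      using integrable_cauchy by (intro integrable_mult_right)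
  qed (use h_meas h_lim h_bound in auto)
  also have "(\<integral>y. V / \<xi> ^ \<alpha> * exp (- (3 * L / \<xi>) * y\<^sup>2 / 2) \<partial>lborel) =
      V / \<xi> ^ \<alpha> * sqrt (2 * pi / (3 * L / \<xi>))"
    using gaussian_integral[of "3 * L / \<xi>"] L_pos \<xi>_pos by (simp only: integral_mult_right_zero) simp
  finally have lim: "(\<lambda>N. integral\<^sup>L lborel (h N)) \<longlonglongrightarrow> V / \<xi> ^ \<alpha> * sqrt (2 * pi / (3 * L / \<xi>))" .
  have int: "integral\<^sup>L lborel (h N) = suminf (a N) * exp (rate * t N) * t N ^ \<alpha> / sqrt (t N)" for N
  proof -
    have "suminf (a N) = (\<integral>x. a N (nat \<lfloor>x :: real\<rfloor>) \<partial>lborel)"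
      using has_bochner_integral_floor[OF a_nonneg a0(1) a_summable, of N]
      by (simp add: has_bochner_integral_integral_eq)
    also have "\<dots> = sqrt (t N) * (\<integral>y. a N (kk N y) \<partial>lborel)"
      using lborel_integral_real_affine[of "sqrt (t N)" "\<lambda>x. a N (nat \<lfloor>x\<rfloor>)" "\<xi> * t N"] t0[of N]
      by (simp add: kk_def)
    finally show ?thesis using t0[of N] by (simp add: h_def[abs_def] field_simps)
  qed
  show ?thesis using lim unfolding int a_def t_def by (rule LIMSEQ_imp_Suc)
qed

end

section \<open>The mode weights and the subdominant modes\<close>

lemma mode_weight_bounds:
  assumes "0 \<le> z" "z \<le> 1"
  shows "0 \<le> mode_weight z k j" "mode_weight z k j \<le> real k"
proof -
  show "0 \<le> mode_weight z k j" unfolding mode_weight_def using assms by (intro sum_nonneg) auto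
  have "mode_weight z k j \<le> (\<Sum>b\<in>{1..<k}. 1 * 1)"
    unfolding mode_weight_def using assms
    by (intro sum_mono mult_mono) (auto intro: power_le_one simp: abs_square_le_1)
  then show "mode_weight z k j \<le> real k" by simp
qed

lemma mode_weight_0: "mode_weight z k 0 = 0"
  by (simp add: mode_weight_def)

text \<open>
  This is the symmetry between \<open>j\<close> and \<open>k - j\<close>, under which the cosines change their sign only.
\<close>

lemma mode_weight_mirror:
  assumes "k > 0"
  shows "mode_weight z k (k - 1) = mode_weight z k 1"
  unfolding mode_weight_def
proof (intro sum.cong refl arg_cong2[where f = "(*)"])
  fix b
  have "pi * real (k - 1) * real b / real k = real b * pi - pi * real 1 * real b / real k"
    using assms by (simp add: of_nat_diff field_simps)
  then show "(sin (pi * real (k - 1) * real b / real k))\<^sup>2 = (sin (pi * real 1 * real b / real k))\<^sup>2"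
    by (simp only: sin_diff sin_npi cos_npi) (simp add: power_mult_distrib flip: power_mult)
qed

lemma mode_weight_one:
  assumes "k \<ge> 2"
  shows "mode_weight 1 k 1 = real k / 2"
proof -
  have "{..<k} = insert 0 {1..<k}" using assms by auto
  then have "mode_weight 1 k 1 = (\<Sum>j<k. sin (pi * real j * of_int 1 / real k) * sin (pi * real j * of_int 1 / real k))"
    by (simp add: mode_weight_def power2_eq_square)
  also have "\<dots> = real k / 2"
    using assms by (subst sin_orthogonal) auto
  finally show ?thesis .
qed

text \<open>
  Subtracting \<open>z\<close> times the series from the series replaces the squares by odd numbers.
\<close>

lemma sums_square_geometric:
  fixes z :: real
  assumes "0 < z" "z < 1"
  shows "(\<lambda>n. (real n + 1)\<^sup>2 * z ^ n) sums ((1 + z) / (1 - z) ^ 3)"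
proof -
  \<comment> \<open>One factor \<open>w ^ n\<close> of \<open>z ^ n\<close> absorbs the square, the other one is summable.\<close>
  define w where "w = sqrt z"
  have w: "0 < w" "w < 1" "z = w * w" using assms by (auto simp: w_def)
  have "summable (\<lambda>n. (real n + 1)\<^sup>2 * z ^ n)"
  proof (rule summable_comparison_test_bigo)
    show "summable (\<lambda>n. norm (w ^ n))" using w by simp
    have "(\<lambda>n. (real n + 1)\<^sup>2 * w ^ n) \<in> O(\<lambda>n. 1)" using w(1,2) by real_asymp
    then have "(\<lambda>n. (real n + 1)\<^sup>2 * w ^ n * w ^ n) \<in> O(\<lambda>n. 1 * w ^ n)"
      by (rule landau_o.big.mult_right)
    then show "(\<lambda>n. (real n + 1)\<^sup>2 * z ^ n) \<in> O(\<lambda>n. w ^ n)"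
      by (simp add: w(3) power_mult_distrib mult.assoc)
  qed
  then obtain S where S: "(\<lambda>n. (real n + 1)\<^sup>2 * z ^ n) sums S" by (auto simp: summable_def)
  have "(\<lambda>n. z * ((real n + 1)\<^sup>2 * z ^ n)) sums (z * S)" by (rule sums_mult[OF S])
  then have "(\<lambda>n. (real (Suc n))\<^sup>2 * z ^ Suc n) sums (z * S)" by (simp add: mult_ac add.commute)
  then have zS: "(\<lambda>n. (real n)\<^sup>2 * z ^ n) sums (z * S)" by (subst (asm) sums_Suc_iff) simp
  have "(\<lambda>n. real (Suc n) * z ^ n) sums (1 / (1 - z)\<^sup>2)"
    using geometric_deriv_sums[of z] assms by simp
  then have "(\<lambda>n. 2 * (real (Suc n) * z ^ n) - z ^ n) sums (2 * (1 / (1 - z)\<^sup>2) - 1 / (1 - z))"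
    using assms by (intro sums_diff sums_mult geometric_sums) auto
  moreover have "(\<lambda>n. (real n + 1)\<^sup>2 * z ^ n - (real n)\<^sup>2 * z ^ n) = (\<lambda>n. 2 * (real (Suc n) * z ^ n) - z ^ n)"
    by (rule ext) (simp add: power2_eq_square algebra_simps)
  ultimately have "S - z * S = 2 * (1 / (1 - z)\<^sup>2) - 1 / (1 - z)"
    using sums_diff[OF S zS] by (metis sums_unique2)
  moreover have "2 * (1 / (1 - z)\<^sup>2) - 1 / (1 - z) = (1 + z) / (1 - z)\<^sup>2"
    using assms by (simp add: divide_simps power2_eq_square) (simp add: algebra_simps)
  ultimately have "S * (1 - z) = (1 + z) / (1 - z)\<^sup>2" by (simp add: algebra_simps)
  then have "S = (1 + z) / (1 - z)\<^sup>2 / (1 - z)" using assms by (simp only: eq_divide_eq) simp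
  also have "\<dots> = (1 + z) / (1 - z) ^ 3" by (simp add: power2_eq_square power3_eq_cube mult.assoc)
  finally have "S = (1 + z) / (1 - z) ^ 3" .
  with S show ?thesis by simp
qed

text \<open>
  Multiplied by \<open>k^2\<close>, the summand for fixed \<open>b\<close> converges to \<open>pi^2 b^2 z ^ (b - 1)\<close>, which also
  dominates it; so the limit may be taken term by term.
\<close>

lemma mode_weight_limit:
  assumes z: "0 < z" "z < 1"
  shows "(\<lambda>k. (real k)\<^sup>2 * mode_weight z k 1) \<longlonglongrightarrow> pi\<^sup>2 * ((1 + z) / (1 - z) ^ 3)"
proof -
  define a where "a b k = (if b + 1 < k then z ^ b * (real k * sin (pi * real (b + 1) / real k))\<^sup>2 else 0)"
    for b k :: nat
  have lim: "(\<lambda>k. a b k) \<longlonglongrightarrow> z ^ b * (pi * real (b + 1))\<^sup>2" for b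
  proof -
    have "(\<lambda>k. real k * sin (pi * real (b + 1) / real k)) \<longlonglongrightarrow> pi * real (b + 1)"
      by real_asymp
    then have "(\<lambda>k. z ^ b * (real k * sin (pi * real (b + 1) / real k))\<^sup>2) \<longlonglongrightarrow> z ^ b * (pi * real (b + 1))\<^sup>2"
      by (intro tendsto_mult_left tendsto_power)
    moreover have "\<forall>\<^sub>F k in sequentially. z ^ b * (real k * sin (pi * real (b + 1) / real k))\<^sup>2 = a b k"
      using eventually_gt_at_top[of "b + 1"] by eventually_elim (simp add: a_def)
    ultimately show ?thesis by (rule Lim_transform_eventually)
  qed
  have sums: "(\<lambda>b. z ^ b * (pi * real (b + 1))\<^sup>2) sums (pi\<^sup>2 * ((1 + z) / (1 - z) ^ 3))"
    using sums_mult[OF sums_square_geometric[OF z], of "pi\<^sup>2"]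
    by (simp add: power_mult_distrib mult_ac add.commute)
  have bound: "norm (a b k) \<le> z ^ b * (pi * real (b + 1))\<^sup>2" for b k
  proof (cases "b + 1 < k")
    case True
    have "\<bar>real k * sin (pi * real (b + 1) / real k)\<bar> \<le> real k * \<bar>pi * real (b + 1) / real k\<bar>"
      unfolding abs_mult using abs_sin_x_le_abs_x[of "pi * real (b + 1) / real k"]
      by (intro mult_mono) auto
    also have "\<dots> = \<bar>pi * real (b + 1)\<bar>" using True by (simp add: abs_mult)
    finally have "(real k * sin (pi * real (b + 1) / real k))\<^sup>2 \<le> (pi * real (b + 1))\<^sup>2"
      by (simp only: abs_le_square_iff)
    then show ?thesis using True z by (simp add: a_def mult_left_mono del: of_nat_add)
  qed (use z in \<open>simp add: a_def\<close>)
  have "((\<lambda>k. \<Sum>b. a b k) \<longlongrightarrow> (\<Sum>b. z ^ b * (pi * real (b + 1))\<^sup>2)) sequentially"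
    using tannerys_theorem[of a "\<lambda>b. z ^ b * (pi * real (b + 1))\<^sup>2" sequentially "\<lambda>b. z ^ b * (pi * real (b + 1))\<^sup>2"]
      lim bound sums by (auto simp: sums_iff intro: always_eventually)
  moreover have "(\<Sum>b. a b k) = (real k)\<^sup>2 * mode_weight z k 1" for k
  proof -
    have "(\<Sum>b. a b k) = (\<Sum>b\<in>{..<k - 1}. a b k)"
      by (rule suminf_finite) (auto simp: a_def)
    also have "\<dots> = (\<Sum>b\<in>{1..<k}. (real k)\<^sup>2 * (z ^ (b - 1) * (sin (pi * real 1 * real b / real k))\<^sup>2))"
      by (rule sum.reindex_bij_witness[of _ "\<lambda>b. b - 1" "\<lambda>b. b + 1"])
         (auto simp: a_def power_mult_distrib)
    finally show ?thesis by (simp only: mode_weight_def sum_distrib_left)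
  qed
  ultimately show ?thesis using sums by (simp add: sums_iff)
qed

definition mode_sum :: "real \<Rightarrow> nat \<Rightarrow> nat \<Rightarrow> real" where
  "mode_sum z N k = 2 / real k * (\<Sum>j<k. mode_weight z k j * cos (pi * real j / real k) ^ (2 * N))"

text \<open>
  The modes \<open>1\<close> and \<open>k - 1\<close> together, including the factor \<open>2 / k\<close>.
\<close>

definition lead_weight :: "real \<Rightarrow> nat \<Rightarrow> real" where
  "lead_weight z k = (if k < 2 then 0 else 4 / real k * mode_weight z k 1)"

lemma abs_cos_le:
  fixes x m :: real
  assumes "0 \<le> m" "m \<le> pi / 2" "m \<le> x" "x \<le> pi - m"
  shows "\<bar>cos x\<bar> \<le> exp (- m\<^sup>2 / 2)"
proof -
  have "cos x \<le> cos m" using assms by (intro cos_monotone_0_pi_le) auto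
  moreover have "cos (pi - x) \<le> cos m" using assms by (intro cos_monotone_0_pi_le) auto
  moreover have "cos m \<le> exp (- m\<^sup>2 / 2)" using assms by (intro cos_le_gaussian)
  ultimately show ?thesis by simp
qed

text \<open>
  For the modes from \<open>2\<close> to \<open>k - 2\<close> the angle keeps a distance of at least \<open>2 pi / k\<close> from 0 and
  from \<open>pi\<close>. For \<open>k = 2\<close> the two leading modes coincide, but then the cosine vanishes.
\<close>

lemma mode_sum_bounds:
  assumes z: "0 \<le> z" "z \<le> 1" and k: "k \<ge> 2" and N: "N \<ge> 1"
  shows "lead_weight z k * cos (pi / real k) ^ (2 * N) \<le> mode_sum z N k"
    and "mode_sum z N k \<le> lead_weight z k * cos (pi / real k) ^ (2 * N) +
           2 * real k * exp (- (4 * pi\<^sup>2 * real N / (real k)\<^sup>2))"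
proof -
  define f where "f j = mode_weight z k j * cos (pi * real j / real k) ^ (2 * N)" for j
  have f_nonneg: "f j \<ge> 0" for j
    unfolding f_def by (intro mult_nonneg_nonneg mode_weight_bounds z zero_le_even_power')
  have k0: "real k > 0" using k by simp
  have main: "lead_weight z k * cos (pi / real k) ^ (2 * N) \<le> mode_sum z N k \<and>
     mode_sum z N k \<le> lead_weight z k * cos (pi / real k) ^ (2 * N) +
           2 * real k * exp (- (4 * pi\<^sup>2 * real N / (real k)\<^sup>2))"
  proof (cases "k = 2")
    case True
    have "{..<2 :: nat} = {0, 1}" by auto
    then have "mode_sum z N k = 0" unfolding mode_sum_def True using N
      by (simp add: mode_weight_0 cos_pi_half zero_power)
    moreover have "cos (pi / real k) ^ (2 * N) = 0" using True N by (simp add: cos_pi_half zero_power)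
    ultimately show ?thesis by (simp only:) simp
  next
    case False
    with k have k3: "k \<ge> 3" by simp
    have set: "{..<k} = {0, 1, k - 1} \<union> {2..<k - 1}" using k3 by auto
    have clast: "cos (pi * real (k - 1) / real k) = - cos (pi / real k)"
    proof -
      have "pi * real (k - 1) / real k = pi - pi / real k" using k3 by (simp add: of_nat_diff field_simps)
      then show ?thesis by simp
    qed
    have "mode_weight z k (k - 1) = mode_weight z k 1" using k3 by (intro mode_weight_mirror) simp
    then have flast: "f (k - 1) = f 1" unfolding f_def clast by simp
    have "(\<Sum>j<k. f j) = f 0 + (f 1 + f (k - 1)) + (\<Sum>j\<in>{2..<k - 1}. f j)"
      unfolding set using k3 by (subst sum.union_disjoint) auto
    also have "\<dots> = 2 * f 1 + (\<Sum>j\<in>{2..<k - 1}. f j)"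
      unfolding flast by (simp add: f_def mode_weight_0)
    finally have eq: "mode_sum z N k = lead_weight z k * cos (pi / real k) ^ (2 * N) +
        2 / real k * (\<Sum>j\<in>{2..<k - 1}. f j)"
      using k unfolding mode_sum_def f_def[symmetric] lead_weight_def
      by (simp add: f_def algebra_simps)
    have "(\<Sum>j\<in>{2..<k - 1}. f j) \<le> (\<Sum>j\<in>{2..<k - 1}. real k * exp (- (4 * pi\<^sup>2 * real N / (real k)\<^sup>2)))"
    proof (rule sum_mono)
      fix j assume j: "j \<in> {2..<k - 1}"
      then have jk: "real j \<ge> 2" "real j \<le> real k - 2" by auto
      have "\<bar>cos (pi * real j / real k)\<bar> \<le> exp (- (2 * pi / real k)\<^sup>2 / 2)"
      proof (rule abs_cos_le)
        show "2 * pi / real k \<le> pi / 2" using jk k0 by (simp add: field_simps)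
        show "2 * pi / real k \<le> pi * real j / real k" using jk k0 by (intro divide_right_mono) auto
        have "pi * (real j + 2) \<le> pi * real k" using jk by (intro mult_left_mono) auto
        then show "pi * real j / real k \<le> pi - 2 * pi / real k" using k0 by (simp add: field_simps)
      qed auto
      then have "\<bar>cos (pi * real j / real k)\<bar> ^ (2 * N) \<le> exp (- (2 * pi / real k)\<^sup>2 / 2) ^ (2 * N)"
        by (intro power_mono) auto
      also have "\<dots> = exp (- (4 * pi\<^sup>2 * real N / (real k)\<^sup>2))"
        by (simp add: power_divide power_mult_distrib flip: exp_of_nat_mult)
      finally have "cos (pi * real j / real k) ^ (2 * N) \<le> exp (- (4 * pi\<^sup>2 * real N / (real k)\<^sup>2))"
        by (simp add: power_even_abs)
      then show "f j \<le> real k * exp (- (4 * pi\<^sup>2 * real N / (real k)\<^sup>2))"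
        unfolding f_def using mode_weight_bounds[OF z]
        by (intro mult_mono) (auto intro!: zero_le_even_power')
    qed
    also have "\<dots> \<le> real k * (real k * exp (- (4 * pi\<^sup>2 * real N / (real k)\<^sup>2)))"
      by (simp add: mult_right_mono)
    finally have "2 / real k * (\<Sum>j\<in>{2..<k - 1}. f j) \<le>
        2 / real k * (real k * (real k * exp (- (4 * pi\<^sup>2 * real N / (real k)\<^sup>2))))"
      using k0 by (intro mult_left_mono) auto
    also have "\<dots> = 2 * real k * exp (- (4 * pi\<^sup>2 * real N / (real k)\<^sup>2))" using k0 by simp
    moreover have "0 \<le> 2 / real k * (\<Sum>j\<in>{2..<k - 1}. f j)"
      using f_nonneg by (intro mult_nonneg_nonneg sum_nonneg) auto
    ultimately show ?thesis unfolding eq by simp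
  qed
  show "lead_weight z k * cos (pi / real k) ^ (2 * N) \<le> mode_sum z N k"
    and "mode_sum z N k \<le> lead_weight z k * cos (pi / real k) ^ (2 * N) +
           2 * real k * exp (- (4 * pi\<^sup>2 * real N / (real k)\<^sup>2))"
    using main by auto
qed

context laplace_scale
begin

text \<open>
  Quadrupling \<open>N\<close> multiplies the minimal phase by the cube root of 4; the bound
  \<open>(3/2)^3 \<le> 4\<close> keeps the constant rational.
\<close>

lemma phase_4_ge:
  assumes "k > 0" "t \<ge> 0"
  shows "L * k + 4 * pi\<^sup>2 * t ^ 3 / k\<^sup>2 \<ge> 3 / 2 * rate * t"
proof -
  have "3 / 2 * rate * t \<le> rate * (3 / 2 * t) + excess k (3 / 2 * t)"
    using excess_nonneg[of k "3 / 2 * t"] assms by simp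
  also have "\<dots> = L * k + pi\<^sup>2 * (3 / 2 * t) ^ 3 / k\<^sup>2" using phase_eq[OF assms(1)] by simp
  also have "pi\<^sup>2 * (3 / 2 * t) ^ 3 / k\<^sup>2 \<le> 4 * pi\<^sup>2 * t ^ 3 / k\<^sup>2"
    using assms by (intro divide_right_mono) (auto simp: power3_eq_cube intro!: mult_right_mono)
  finally show ?thesis by simp
qed

lemma lead_weight_summable:
  assumes z: "0 \<le> z" "z \<le> 1"
  shows "summable (\<lambda>k. lead_weight z k * exp (- L * real k) * cos (pi / real k) ^ (2 * N))"
proof (rule summable_comparison_test)
  have "norm (lead_weight z k * exp (- L * real k) * cos (pi / real k) ^ (2 * N)) \<le> 4 * exp (- L) ^ k" for k
  proof -
    have lw: "0 \<le> lead_weight z k" "lead_weight z k \<le> 4"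
      using mode_weight_bounds[OF z, of k 1] by (auto simp: lead_weight_def field_simps)
    have "cos (pi / real k) ^ (2 * N) \<le> 1"
      unfolding power_mult by (rule power_le_one) (simp_all add: abs_square_le_1)
    then have "lead_weight z k * exp (- L * real k) * cos (pi / real k) ^ (2 * N) \<le> 4 * exp (- L * real k) * 1"
      using lw by (intro mult_mono mult_nonneg_nonneg zero_le_even_power' order_refl exp_ge_zero) auto
    moreover have "0 \<le> lead_weight z k * exp (- L * real k) * cos (pi / real k) ^ (2 * N)"
      using lw by (intro mult_nonneg_nonneg zero_le_even_power' exp_ge_zero)
    moreover have "exp (- L) ^ k = exp (- L * real k)" by (simp add: exp_of_nat_mult[symmetric] mult.commute)
    ultimately show ?thesis by simp
  qed
  then show "\<exists>N'. \<forall>n\<ge>N'. norm (lead_weight z n * exp (- L * real n) * cos (pi / real n) ^ (2 * N)) \<le> 4 * exp (- L) ^ n"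
    by blast
  show "summable (\<lambda>k. 4 * exp (- L) ^ k)"
    using L_pos by (intro summable_mult summable_geometric) auto
qed

text \<open>
  The subdominant modes decay at least like \<open>exp (- 5/4 * rate * t)\<close>: of the bound
  \<open>3/2 * rate * t\<close> on their phase, five sixths are used for the decay in \<open>t\<close>, and one sixth of the
  linear part of the phase makes the series over \<open>k\<close> converge.
\<close>

lemma mode_sum_limit:
  fixes \<alpha> :: nat
  assumes z: "0 \<le> z" "z \<le> 1" and lim: "(\<lambda>k. real k ^ \<alpha> * lead_weight z k) \<longlonglongrightarrow> V"
  shows "(\<lambda>N. (\<Sum>K. exp (- L * real (K + 2)) * mode_sum z N (K + 2)) *
            exp (rate * root 3 (real N)) * root 3 (real N) ^ \<alpha> / sqrt (root 3 (real N)))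
     \<longlonglongrightarrow> V / \<xi> ^ \<alpha> * sqrt (2 * pi / (3 * L / \<xi>))"
proof -
  define t where "t N = root 3 (real N)" for N
  define E where "E N = exp (rate * t N) * t N ^ \<alpha> / sqrt (t N)" for N
  define M where "M N k = lead_weight z k * exp (- L * real k) * cos (pi / real k) ^ (2 * N)" for N k
  define T where "T N k = exp (- L * real k) * mode_sum z N k" for N k
  define R where "R k = 2 * real k * exp (- (L * real k / 6))" for k
  have E_nonneg: "E N \<ge> 0" for N by (simp add: E_def t_def)
  have rate_pos: "rate > 0" using L_pos \<xi>_pos by (simp add: rate_def)
  have "(\<lambda>n. real n * exp (- (L / 6) * real n)) \<in> O(\<lambda>n. exp (- (L / 12) * real n))"
    using L_pos by real_asymp
  moreover have "summable (\<lambda>n. norm (exp (- (L / 12) * real n)))"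
  proof -
    have "exp (- (L / 12) * real n) = exp (- (L / 12)) ^ n" for n
      by (simp add: exp_of_nat_mult[symmetric] mult.commute)
    then show ?thesis using L_pos by (simp add: summable_geometric)
  qed
  ultimately have "summable (\<lambda>n. real n * exp (- (L / 6) * real n))"
    by (rule summable_comparison_test_bigo[rotated])
  from summable_mult[OF this, of 2] have R_summable: "summable R"
    by (simp add: R_def[abs_def] mult.assoc)
  have R_nonneg: "R k \<ge> 0" for k by (simp add: R_def)
  have M_summable: "summable (M N)" for N unfolding M_def by (rule lead_weight_summable[OF z])
  have bounds: "M N k \<le> T N k" "T N k \<le> M N k + exp (- (5 / 4 * rate * t N)) * R k" if "k \<ge> 2" "N \<ge> 1" for N k
  proof -
    have k: "real k > 0" using that by simp
    note b = mode_sum_bounds[OF z that]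
    have "exp (- L * real k) * (lead_weight z k * cos (pi / real k) ^ (2 * N)) \<le> T N k"
      unfolding T_def using b(1) by (intro mult_left_mono) auto
    then show "M N k \<le> T N k" by (simp add: M_def mult_ac)
    let ?Q = "4 * pi\<^sup>2 * real N / (real k)\<^sup>2"
    have "T N k \<le> exp (- L * real k) * (lead_weight z k * cos (pi / real k) ^ (2 * N) + 2 * real k * exp (- ?Q))"
      unfolding T_def using b(2) by (intro mult_left_mono) auto
    also have "\<dots> = M N k + 2 * real k * (exp (- L * real k) * exp (- ?Q))"
      by (simp add: M_def algebra_simps)
    also have "exp (- L * real k) * exp (- ?Q) \<le> exp (- (L * real k / 6)) * exp (- (5 / 4 * rate * t N))"
    proof -
      have "t N ^ 3 = real N" by (simp add: t_def)
      then have "3 / 2 * rate * t N \<le> L * real k + ?Q"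
        using phase_4_ge[OF k, of "t N"] by (simp add: t_def)
      moreover have "?Q \<ge> 0" by simp
      ultimately have "- L * real k + - ?Q \<le> - (L * real k / 6) + - (5 / 4 * rate * t N)" by linarith
      then show ?thesis unfolding exp_add[symmetric] by simp
    qed
    finally show "T N k \<le> M N k + exp (- (5 / 4 * rate * t N)) * R k"
      using k by (simp add: R_def mult_ac)
  qed
  have shift: "summable (\<lambda>K. M N (K + 2))" "(\<Sum>K. M N (K + 2)) = suminf (M N)" for N
  proof -
    show "summable (\<lambda>K. M N (K + 2))" using M_summable by (rule summable_ignore_initial_segment)
    have "M N 0 = 0" "M N 1 = 0" by (simp_all add: M_def lead_weight_def)
    then show "(\<Sum>K. M N (K + 2)) = suminf (M N)"
      using suminf_split_initial_segment[OF M_summable, of N 2] by (simp add: numeral_2_eq_2)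
  qed
  have R2: "summable (\<lambda>K. R (K + 2))" using R_summable by (rule summable_ignore_initial_segment)
  have diff: "\<bar>(\<Sum>K. T N (K + 2)) - suminf (M N)\<bar> \<le> exp (- (5 / 4 * rate * t N)) * (\<Sum>K. R (K + 2))"
    if N: "N \<ge> 1" for N
  proof -
    have s: "summable (\<lambda>K. M N (K + 2) + exp (- (5 / 4 * rate * t N)) * R (K + 2))"
      using shift(1) R2 by (intro summable_add summable_mult)
    have M_nonneg: "M N k \<ge> 0" for k
      unfolding M_def lead_weight_def using mode_weight_bounds[OF z]
      by (intro mult_nonneg_nonneg zero_le_even_power') auto
    have T_summable: "summable (\<lambda>K. T N (K + 2))"
    proof (rule summable_comparison_test[OF _ s], intro exI allI impI)
      fix K
      show "norm (T N (K + 2)) \<le> M N (K + 2) + exp (- (5 / 4 * rate * t N)) * R (K + 2)"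
        using bounds[of "K + 2" N] N M_nonneg[of "K + 2"] by simp
    qed
    have "(\<Sum>K. M N (K + 2)) \<le> (\<Sum>K. T N (K + 2))"
      using bounds N by (intro suminf_le shift(1) T_summable) auto
    moreover have "(\<Sum>K. T N (K + 2)) \<le> (\<Sum>K. M N (K + 2) + exp (- (5 / 4 * rate * t N)) * R (K + 2))"
      using bounds N by (intro suminf_le s T_summable) auto
    moreover have "(\<Sum>K. M N (K + 2) + exp (- (5 / 4 * rate * t N)) * R (K + 2)) =
        (\<Sum>K. M N (K + 2)) + exp (- (5 / 4 * rate * t N)) * (\<Sum>K. R (K + 2))"
      using shift(1) R2 by (simp add: suminf_add[symmetric] suminf_mult[symmetric] summable_mult)
    ultimately show ?thesis using shift(2) by simp
  qed
  have main: "(\<lambda>N. suminf (M N) * E N) \<longlonglongrightarrow> V / \<xi> ^ \<alpha> * sqrt (2 * pi / (3 * L / \<xi>))"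
  proof -
    have "(\<lambda>N. (\<Sum>k. lead_weight z k * exp (- L * real k) * cos (pi / real k) ^ (2 * N)) *
            exp (rate * root 3 (real N)) * root 3 (real N) ^ \<alpha> / sqrt (root 3 (real N)))
         \<longlonglongrightarrow> V / \<xi> ^ \<alpha> * sqrt (2 * pi / (3 * L / \<xi>))"
    proof (rule laplace_sum)
      show "0 \<le> lead_weight z k" for k
        using mode_weight_bounds[OF z, of k 1] by (simp add: lead_weight_def)
    qed (use lim in \<open>simp_all add: lead_weight_def\<close>)
    then show ?thesis by (simp only: M_def[abs_def] E_def t_def times_divide_eq_right mult.assoc)
  qed
  have err: "(\<lambda>N. ((\<Sum>K. T N (K + 2)) - suminf (M N)) * E N) \<longlonglongrightarrow> 0"
  proof (rule Lim_null_comparison)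
    show "\<forall>\<^sub>F N in sequentially. norm (((\<Sum>K. T N (K + 2)) - suminf (M N)) * E N) \<le>
        (\<Sum>K. R (K + 2)) * (exp (- (1 / 4 * rate * t N)) * t N ^ \<alpha> / sqrt (t N))"
      using eventually_ge_at_top[of 1]
    proof eventually_elim
      case (elim N)
      have "norm (((\<Sum>K. T N (K + 2)) - suminf (M N)) * E N) \<le> exp (- (5 / 4 * rate * t N)) * (\<Sum>K. R (K + 2)) * E N"
        using diff[OF elim] E_nonneg[of N] by (simp add: abs_mult mult_right_mono)
      also have "\<dots> = (\<Sum>K. R (K + 2)) * ((exp (- (5 / 4 * rate * t N)) * exp (rate * t N)) * t N ^ \<alpha> / sqrt (t N))"
        by (simp add: E_def mult_ac)
      also have "exp (- (5 / 4 * rate * t N)) * exp (rate * t N) = exp (- (1 / 4 * rate * t N))"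
        unfolding exp_add[symmetric] by simp
      finally show ?case .
    qed
    have t_lim: "filterlim t at_top sequentially" unfolding t_def by real_asymp
    have "((\<lambda>x. exp (- (1 / 4 * rate * x)) * x ^ \<alpha> / sqrt x) \<longlongrightarrow> 0) at_top"
      using rate_pos by real_asymp
    from tendsto_mult_right_zero[OF filterlim_compose[OF this t_lim], of "\<Sum>K. R (K + 2)"]
    show "(\<lambda>N. (\<Sum>K. R (K + 2)) * (exp (- (1 / 4 * rate * t N)) * t N ^ \<alpha> / sqrt (t N))) \<longlonglongrightarrow> 0" .
  qed
  from tendsto_add[OF main err]
  have "(\<lambda>N. (\<Sum>K. T N (K + 2)) * E N) \<longlonglongrightarrow> V / \<xi> ^ \<alpha> * sqrt (2 * pi / (3 * L / \<xi>))"
    by (simp add: algebra_simps)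
  then show ?thesis by (simp add: T_def E_def t_def mult.assoc)
qed

end

section \<open>The constants and the return probability\<close>

text \<open>
  The constants are given by real powers; their cubes identify them with rational expressions
  in \<open>xi1\<close>.
\<close>

lemma cube_powr:
  fixes a b :: real
  assumes "a \<ge> 0" "b > 0" "a ^ 3 = b\<^sup>2"
  shows "b powr (2 / 3) = a"
proof -
  have "b powr (2 / 3) = (b powr 2) powr (1 / 3)" by (simp add: powr_powr)
  also have "b powr 2 = a ^ 3" using assms by simp
  also have "(a ^ 3) powr (1 / 3) = root 3 (a ^ 3)" using assms by (simp add: root_powr_inverse)
  finally show ?thesis using assms(1) by (simp add: real_root_power_cancel)
qed

context
  fixes q :: nat
  assumes q: "q \<ge> 2"
begin

lemma ln_q_pos: "ln (real q) > 0"
  using q by simp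

lemma xi1_pos: "xi1 q > 0"
  using q by (simp add: xi1_def)

lemma xi1_cubed: "xi1 q ^ 3 * ln (real q) = 2 * pi\<^sup>2"
proof -
  have "xi1 q ^ 3 = 2 * pi\<^sup>2 / ln (real q)"
  proof -
    have "xi1 q ^ 3 = xi1 q powr 3" using xi1_pos by simp
    also have "\<dots> = 2 * pi\<^sup>2 / ln (real q)"
      unfolding xi1_def powr_powr using ln_q_pos by simp
    finally show ?thesis .
  qed
  then show ?thesis using ln_q_pos by simp
qed

lemma laplace_scale_xi1: "laplace_scale (ln (real q)) (xi1 q)"
  by standard (rule ln_q_pos xi1_pos xi1_cubed)+

lemma B1_eq: "B1 q = laplace_scale.rate (ln (real q)) (xi1 q)"
proof -
  interpret laplace_scale "ln (real q)" "xi1 q" by (rule laplace_scale_xi1)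
  have "(pi * ln (real q) / 2) powr (2 / 3) = xi1 q * ln (real q) / 2"
  proof (rule cube_powr)
    have "(xi1 q * ln (real q) / 2) ^ 3 = (xi1 q ^ 3 * ln (real q)) * (ln (real q))\<^sup>2 / 8"
      by (simp add: power_divide power_mult_distrib power2_eq_square power3_eq_cube)
    then show "(xi1 q * ln (real q) / 2) ^ 3 = (pi * ln (real q) / 2)\<^sup>2"
      by (simp add: xi1_cubed power_divide power_mult_distrib)
  qed (use ln_q_pos xi1_pos in auto)
  then show ?thesis by (simp add: B1_def rate_def)
qed

lemma C1_eq: "C1 q = 3 * ln (real q) / xi1 q"
proof -
  have "((ln (real q))\<^sup>2 / (4 * pi)) powr (2 / 3) = ln (real q) / (2 * xi1 q)"
  proof (rule cube_powr)
    have pos: "xi1 q ^ 3 > 0" using xi1_pos by simp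
    have "(ln (real q) / (2 * xi1 q)) ^ 3 = ln (real q) ^ 3 / (8 * xi1 q ^ 3)"
      by (simp add: power_divide power_mult_distrib)
    also have "\<dots> = ln (real q) ^ 4 / (8 * (xi1 q ^ 3 * ln (real q)))"
      using ln_q_pos by (simp add: power_numeral_reduce)
    also have "\<dots> = ((ln (real q))\<^sup>2 / (4 * pi))\<^sup>2"
      unfolding xi1_cubed by (simp add: power_divide power_mult_distrib flip: power_mult)
    finally show "(ln (real q) / (2 * xi1 q)) ^ 3 = ((ln (real q))\<^sup>2 / (4 * pi))\<^sup>2" .
  qed (use ln_q_pos xi1_pos in auto)
  then show ?thesis by (simp add: C1_def)
qed

end

context diestel_leader
begin

text \<open>
  The sum over bridges from \<open>return_probability_sum\<close>, evaluated by \<open>bridge_sums\<close> at \<open>x = 1 / q\<close> and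
  \<open>y = 1 / r\<close>. Indexing by the width \<open>k = K + 2\<close> accounts for the factor \<open>q^2\<close>.
\<close>

lemma return_probability_modes:
  assumes "q \<ge> 2" "r \<ge> 2"
  shows "DL_prob E1 o1 \<omega>1 E2 o2 \<omega>2 (2 * N) (o1, o2) (o1, o2) =
     rho q r ^ (2 * N) * ((real q - 1) * (real r - 1) * real q / real r *
       (\<Sum>K. exp (- ln (real q) * real (K + 2)) * mode_sum (real q / real r) N (K + 2)))"
proof -
  define x where "x = 1 / real q"
  define y where "y = 1 / real r"
  have xy: "0 < x" "x < 1" "0 < y" "y < 1" using assms by (auto simp: x_def y_def)
  have z: "y / x = real q / real r" by (simp add: x_def y_def)
  let ?B = "{s. length s = 2 * N \<and> pos s = 0}"
  define S where "S = (\<Sum>s\<in>?B. x ^ peak s * y ^ peak (map Not s))"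
  have "(\<Sum>s\<in>?B. real q ^ (N - peak s) * real r ^ (N - peak (map Not s))) =
      (\<Sum>s\<in>?B. (real q * real r) ^ N * (x ^ peak s * y ^ peak (map Not s)))"
  proof (intro sum.cong refl)
    fix s assume "s \<in> ?B"
    then have "count_list s True = N" "count_list s False = N"
      using pos_eq_count[of s] length_eq_count[of s] by auto
    then have "peak s \<le> N" "peak (map Not s) \<le> N"
      using peak_le_count[of s] peak_le_count[of "map Not s"] by (auto simp: count_list_map_Not)
    then show "real q ^ (N - peak s) * real r ^ (N - peak (map Not s)) =
        (real q * real r) ^ N * (x ^ peak s * y ^ peak (map Not s))"
      using assms by (simp add: x_def y_def power_diff power_mult_distrib power_divide)
  qed
  then have prob: "DL_prob E1 o1 \<omega>1 E2 o2 \<omega>2 (2 * N) (o1, o2) (o1, o2) =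
      (real q * real r) ^ N * S / (real q + real r) ^ (2 * N)"
    by (simp add: return_probability_sum S_def sum_distrib_left)
  have "(\<lambda>K. (1 - x) * (1 - y) * 4 ^ N * x ^ K * mode_sum (y / x) N (K + 2)) sums S"
    unfolding mode_sum_def S_def by (rule bridge_sums[OF xy])
  moreover have "(1 - x) * (1 - y) * 4 ^ N * x ^ K * mode_sum (y / x) N (K + 2) =
      4 ^ N * ((real q - 1) * (real r - 1) * real q / real r) *
        (exp (- ln (real q) * real (K + 2)) * mode_sum (real q / real r) N (K + 2))" for K
  proof -
    have "exp (- ln (real q) * real (K + 2)) = exp (- ln (real q)) ^ (K + 2)"
      by (simp only: exp_of_nat_mult[symmetric] mult.commute)
    also have "exp (- ln (real q)) = x" using assms by (simp add: x_def exp_minus inverse_eq_divide)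
    finally have e: "exp (- ln (real q) * real (K + 2)) = x ^ K * x\<^sup>2"
      by (simp only: power_add)
    have c: "(1 - x) * (1 - y) = (real q - 1) * (real r - 1) * real q / real r * x\<^sup>2"
      using assms by (simp add: x_def y_def field_simps power2_eq_square)
    show ?thesis unfolding e z c by simp
  qed
  ultimately have sums: "(\<lambda>K. 4 ^ N * ((real q - 1) * (real r - 1) * real q / real r) *
        (exp (- ln (real q) * real (K + 2)) * mode_sum (real q / real r) N (K + 2))) sums S"
    by simp
  have nz: "4 ^ N * ((real q - 1) * (real r - 1) * real q / real r) \<noteq> 0"
    using assms by simp
  have "S = 4 ^ N * ((real q - 1) * (real r - 1) * real q / real r) *
       (\<Sum>K. exp (- ln (real q) * real (K + 2)) * mode_sum (real q / real r) N (K + 2))"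
  proof -
    have "summable (\<lambda>K. exp (- ln (real q) * real (K + 2)) * mode_sum (real q / real r) N (K + 2))"
      using sums_summable[OF sums] nz by (simp only: summable_cmult_iff) simp
    from sums_unique2[OF sums sums_mult[OF summable_sums[OF this]]] show ?thesis .
  qed
  moreover have "(real q * real r) ^ N * 4 ^ N / (real q + real r) ^ (2 * N) = rho q r ^ (2 * N)"
    by (simp add: rho_def power_mult power_divide power_mult_distrib)
  moreover have "u * S' / d = R * (c * P)" if "S' = b * c * P" "u * b / d = R" for u S' d R c P b :: real
    using that by auto
  ultimately show ?thesis unfolding prob by blast
qed

text \<open>
  Both cases of the theorem at once: only the order \<open>\<alpha>\<close> of decay of the leading weight and its
  leading coefficient \<open>V\<close> depend on whether \<open>q < r\<close>.
\<close>

lemma return_probability_asymp: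
  assumes "q \<ge> 2" "q \<le> r"
    and lim: "(\<lambda>k. real k ^ \<alpha> * lead_weight (real q / real r) k) \<longlonglongrightarrow> V" and V: "V \<noteq> 0"
  shows "(\<lambda>N. DL_prob E1 o1 \<omega>1 E2 o2 \<omega>2 (2 * N) (o1, o2) (o1, o2)) \<sim>[sequentially]
    (\<lambda>N. ((real q - 1) * (real r - 1) * real q / real r * V / xi1 q ^ \<alpha> * (2 * pi / C1 q) powr (1 / 2)) *
       rho q r ^ (2 * N) * exp (- B1 q * real N powr (1 / 3)) * real N powr (1 / 6 - real \<alpha> / 3))"
    (is "?p \<sim>[_] (\<lambda>N. ?A * _ N * _ N * _ N)")
proof -
  interpret laplace_scale "ln (real q)" "xi1 q" by (rule laplace_scale_xi1[OF assms(1)])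
  let ?P = "\<lambda>N. \<Sum>K. exp (- ln (real q) * real (K + 2)) * mode_sum (real q / real r) N (K + 2)"
  let ?c = "(real q - 1) * (real r - 1) * real q / real r"
  define W where "W = V / xi1 q ^ \<alpha> * sqrt (2 * pi / C1 q)"
  have C: "C1 q = 3 * ln (real q) / xi1 q" by (rule C1_eq[OF assms(1)])
  have C_pos: "C1 q > 0" unfolding C using ln_q_pos[OF assms(1)] xi1_pos[OF assms(1)] by simp
  have c: "?c > 0" using assms by simp
  have W: "W \<noteq> 0" using V xi1_pos[OF assms(1)] C_pos by (simp add: W_def)
  have A: "?A = ?c * W" using C_pos by (simp add: W_def powr_half_sqrt)
  have "(\<lambda>N. ?P N * exp (rate * root 3 (real N)) * root 3 (real N) ^ \<alpha> / sqrt (root 3 (real N))) \<longlonglongrightarrow> W"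
    unfolding W_def C using assms by (intro mode_sum_limit lim) auto
  from tendsto_divide[OF this tendsto_const W]
  have lim1: "(\<lambda>N. ?P N * exp (rate * root 3 (real N)) * root 3 (real N) ^ \<alpha> / sqrt (root 3 (real N)) / W) \<longlonglongrightarrow> 1"
    using W by simp
  show ?thesis
  proof (rule asymp_equivI', rule Lim_transform_eventually[OF lim1])
    show "\<forall>\<^sub>F N in sequentially. ?P N * exp (rate * root 3 (real N)) * root 3 (real N) ^ \<alpha> / sqrt (root 3 (real N)) / W =
        ?p N / (?A * rho q r ^ (2 * N) * exp (- B1 q * real N powr (1 / 3)) * real N powr (1 / 6 - real \<alpha> / 3))"
      using eventually_ge_at_top[of 1]
    proof eventually_elim
      case (elim N)
      define t where "t = root 3 (real N)"
      have N: "real N > 0" using elim by simp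
      then have t: "t > 0" by (simp add: t_def)
      have Nt: "real N powr (1 / 3) = t" using N by (simp add: t_def root_powr_inverse)
      have "real N powr (1 / 6 - real \<alpha> / 3) = t powr (1 / 2 - real \<alpha>)"
        unfolding Nt[symmetric] by (simp add: powr_powr field_simps)
      also have "\<dots> = sqrt t / t ^ \<alpha>" using t by (simp add: powr_diff powr_half_sqrt powr_realpow)
      finally have Ns: "real N powr (1 / 6 - real \<alpha> / 3) = sqrt t / t ^ \<alpha>" .
      have rho: "rho q r ^ (2 * N) > 0" using assms by (simp add: rho_def)
      have B: "exp (- B1 q * t) = inverse (exp (rate * t))"
        by (simp add: B1_eq[OF assms(1)] exp_minus)
      have p: "?p N = rho q r ^ (2 * N) * (?c * ?P N)"
        using assms by (intro return_probability_modes) auto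
      have gen: "P * e * T / u / W = (R * (a * P)) / (a * W * R * inverse e * (u / T))"
        if "R > 0" "a > 0" "e > 0" "T > 0" "u > 0" for P e T u R a :: real
        using that W by (simp add: field_simps)
      show ?case
        unfolding p A Nt Ns B t_def[symmetric]
        by (rule gen) (use rho c t in auto)
    qed
  qed
qed

end

theorem theorem5p4:
  fixes q r :: nat
    and E1 :: "'a \<Rightarrow> 'a \<Rightarrow> bool" and o1 :: 'a and \<omega>1 :: "(nat \<Rightarrow> 'a) set"
    and E2 :: "'b \<Rightarrow> 'b \<Rightarrow> bool" and o2 :: 'b and \<omega>2 :: "(nat \<Rightarrow> 'b) set"
  assumes "q \<ge> 2" and "r \<ge> 2"
    and "homogeneous_tree q E1" and "\<omega>1 \<in> ends E1"
    and "homogeneous_tree r E2" and "\<omega>2 \<in> ends E2"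
  shows "(r > q \<longrightarrow>
           (\<lambda>N. DL_prob E1 o1 \<omega>1 E2 o2 \<omega>2 (2 * N) (o1, o2) (o1, o2)) \<sim>[sequentially]
           (\<lambda>N. A1 q r * rho q r ^ (2 * N) * exp (- B1 q * real N powr (1/3))
                  * real N powr (-5/6))) \<and>
         (r = q \<longrightarrow>
           (\<lambda>N. DL_prob E1 o1 \<omega>1 E2 o2 \<omega>2 (2 * N) (o1, o2) (o1, o2)) \<sim>[sequentially]
           (\<lambda>N. A1_bar q * exp (- B1 q * real N powr (1/3)) * real N powr (1/6)))"
proof -
  interpret diestel_leader E1 \<omega>1 E2 \<omega>2 q r o1 o2
    using assms by unfold_locales (auto simp: homogeneous_tree_def)
  show ?thesis
  proof (intro conjI impI)
    assume qr: "r > q"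
    define z where "z = real q / real r"
    have z: "0 < z" "z < 1" using qr assms(1) by (auto simp: z_def)
    define V where "V = 4 * pi\<^sup>2 * ((1 + z) / (1 - z) ^ 3)"
    have "(\<lambda>k. 4 * ((real k)\<^sup>2 * mode_weight z k 1)) \<longlonglongrightarrow> 4 * (pi\<^sup>2 * ((1 + z) / (1 - z) ^ 3))"
      by (intro tendsto_mult_left mode_weight_limit z)
    moreover have "\<forall>\<^sub>F k in sequentially. 4 * ((real k)\<^sup>2 * mode_weight z k 1) = real k ^ 3 * lead_weight z k"
      using eventually_ge_at_top[of 2]
      by eventually_elim (simp add: lead_weight_def power2_eq_square power3_eq_cube)
    ultimately have "(\<lambda>k. real k ^ 3 * lead_weight z k) \<longlonglongrightarrow> V"
      unfolding V_def mult.assoc by (rule Lim_transform_eventually)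
    moreover have "V \<noteq> 0" using z by (simp add: V_def)
    moreover have "(real q - 1) * (real r - 1) * real q / real r * V / xi1 q ^ 3 * (2 * pi / C1 q) powr (1 / 2) = A1 q r"
    proof -
      have "(1 + z) / (1 - z) ^ 3 = (real r)\<^sup>2 * (real q + real r) / (real r - real q) ^ 3"
      proof -
        have "1 + z = (real q + real r) / real r" "1 - z = (real r - real q) / real r"
          using qr by (simp_all add: z_def field_simps)
        then show ?thesis using qr by (simp add: power_divide power2_eq_square power3_eq_cube)
      qed
      moreover have "xi1 q powr (-3) = 1 / xi1 q ^ 3"
        using xi1_pos[OF assms(1)] by (simp add: powr_minus divide_inverse)
      ultimately show ?thesis
        using qr by (simp add: A1_def V_def power2_eq_square) (simp add: mult_ac)
    qed
    moreover have "1 / 6 - real 3 / 3 = (-5/6 :: real)" by simp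
    ultimately show "(\<lambda>N. DL_prob E1 o1 \<omega>1 E2 o2 \<omega>2 (2 * N) (o1, o2) (o1, o2)) \<sim>[sequentially]
           (\<lambda>N. A1 q r * rho q r ^ (2 * N) * exp (- B1 q * real N powr (1/3)) * real N powr (-5/6))"
      using return_probability_asymp[of 3 V] assms(1) qr unfolding z_def by (metis less_imp_le)
  next
    assume qr: "r = q"
    have "\<forall>\<^sub>F k in sequentially. 2 = real k ^ 0 * lead_weight 1 k"
      using eventually_ge_at_top[of 2]
    proof eventually_elim
      case (elim k)
      then show ?case unfolding lead_weight_def mode_weight_one[OF elim] by simp
    qed
    then have "(\<lambda>k. real k ^ 0 * lead_weight 1 k) \<longlonglongrightarrow> 2"
      by (rule Lim_transform_eventually[OF tendsto_const])
    moreover have "rho q q = 1" using assms(1) by (simp add: rho_def)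
    moreover have "real q / real q = 1" using assms(1) by simp
    moreover have "(real q - 1) * (real q - 1) * real q / real q * 2 / xi1 q ^ 0 * (2 * pi / C1 q) powr (1 / 2) = A1_bar q"
      using assms(1) by (simp add: A1_bar_def power2_eq_square)
    ultimately show "(\<lambda>N. DL_prob E1 o1 \<omega>1 E2 o2 \<omega>2 (2 * N) (o1, o2) (o1, o2)) \<sim>[sequentially]
           (\<lambda>N. A1_bar q * exp (- B1 q * real N powr (1/3)) * real N powr (1/6))"
      using return_probability_asymp[of 0 2] assms(1) qr by simp
  qed
qed

end
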